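(* For any real $p>1$ there exists a constant $C=C(p)>0$, depending only on $p$, such that for every real number $n>0$ and every function $f\in H^p$ which is mean $n$-valent in $\mathbb{D}$, $$\int_{\mathbb{D}} |f'(z)|\,\mathrm{d}\mathcal{A}(z) \le C \sqrt{\log(n+1)}\, \|f\|_{H^p}.$$
   Context: $\mathbb{D}$ is the open unit disc in $\mathbb{C}$, $\mathcal{A}$ is the area (planar Lebesgue) measure, and $H^p$ is the standard Hardy space in $\mathbb{D}$ with norm $\|\cdot\|_{H^p}$. For a function $f$ analytic in a domain $G\subset\mathbb{C}$ and $w\in\mathbb{C}$, let $n(w)$ be the number of solutions of the equation $f(z)=w$ in $G$, counting multiplicities. For a positive real number $n$ (not necessarily an integer), $f$ is called mean $n$-valent in $G$ if for every $R>0$ $$\frac{1}{\pi}\int_0^R\int_0^{2\pi} n(re^{it})\,\mathrm{d}t\, r\,\mathrm{d}r \le nR^2.$$ *)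

theory Defs
  imports "HOL-Complex_Analysis.Complex_Analysis"
begin

text \<open>Multiplicity of \<open>z\<close> as a solution of \<open>f z = w\<close>; it is infinite iff \<open>f\<close> is identically
  \<open>w\<close> near \<open>z\<close>, a case in which \<^const>\<open>zorder\<close> is unspecified.\<close>

definition solution_mult :: "(complex \<Rightarrow> complex) \<Rightarrow> complex \<Rightarrow> complex \<Rightarrow> ennreal" where
  "solution_mult f w z =
     (if eventually (\<lambda>x. f x = w) (nhds z) then \<infinity>
      else of_nat (nat (zorder (\<lambda>x. f x - w) z)))"

definition solution_count :: "(complex \<Rightarrow> complex) \<Rightarrow> complex set \<Rightarrow> complex \<Rightarrow> ennreal" where
  "solution_count f G w = (\<Sum>\<^sub>\<infinity>z\<in>{z\<in>G. f z = w}. solution_mult f w z)"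

definition mean_valent_on :: "real \<Rightarrow> (complex \<Rightarrow> complex) \<Rightarrow> complex set \<Rightarrow> bool" where
  "mean_valent_on n f G \<longleftrightarrow> f holomorphic_on G \<and>
     (\<forall>R>0. ennreal (1 / pi) *
        (\<integral>\<^sup>+r\<in>{0..R}. (\<integral>\<^sup>+t\<in>{0..2*pi}. solution_count f G (of_real r * cis t) \<partial>lborel) * ennreal r \<partial>lborel)
        \<le> ennreal (n * R\<^sup>2))"

definition hardy_mean :: "real \<Rightarrow> (complex \<Rightarrow> complex) \<Rightarrow> real \<Rightarrow> real" where
  "hardy_mean p f r =
     (1 / (2 * pi) * integral {0..2*pi} (\<lambda>t. norm (f (of_real r * cis t)) powr p)) powr (1 / p)"

definition hardy_space :: "real \<Rightarrow> (complex \<Rightarrow> complex) set" where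
  "hardy_space p = {f. f holomorphic_on ball 0 1 \<and> bdd_above (hardy_mean p f ` {0..<1})}"

definition hardy_norm :: "real \<Rightarrow> (complex \<Rightarrow> complex) \<Rightarrow> real" where
  "hardy_norm p f = (SUP r\<in>{0..<1}. hardy_mean p f r)"

end

theory Submission
  imports Defs
begin

text \<open>
  Put \<open>q = min p 2\<close>, \<open>N = \<parallel>f\<parallel>\<close>, \<open>A = |f|\<^sup>2 + N\<^sup>2\<close>, \<open>K = q / (q - 1)\<close> and \<open>a = (n + 1) powr (-K)\<close>.
  On the disc of radius \<open>1 - a\<close> the Hardy--Stein identity bounds the integral of
  \<open>|f'|\<^sup>2 A powr (q/2 - 1) (1 - |z|)\<close> by a multiple of \<open>N powr q\<close>, so that Cauchy--Schwarz costs
  the factor \<open>sqrt (ln (1/a))\<close>, a multiple of \<open>sqrt (ln (n + 1))\<close>.  On the remaining ring the area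
  formula and mean valence, applied on the dyadic levels of \<open>|f|\<close>, bound the integral of
  \<open>|f'|\<^sup>2 A powr (-(q + 1)/2)\<close> by a multiple of \<open>n N powr (1 - q)\<close>, while the growth estimate
  \<open>|f z| \<le> c N (1 - |z|) powr (-1/q)\<close> bounds that of \<open>A powr ((q + 1)/2)\<close> by a multiple of
  \<open>N powr (q + 1) a powr (1 - 1/q) = N powr (q + 1) / (n + 1)\<close>; this needs \<open>q > 1\<close>.
  Cauchy--Schwarz now gives \<open>N sqrt (n / (n + 1))\<close>, and \<open>n / (n + 1) \<le> ln (n + 1)\<close>.
\<close>

subsection \<open>Change of variables in the plane\<close>

text \<open>Neither estimate works on the whole disc: the weight \<open>1 - |z|\<close> makes
  Cauchy--Schwarz diverge logarithmically at the unit circle, and mean valence alone costs a factor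
  \<open>sqrt n\<close>. The ring is cut thin enough to cancel \<open>n\<close>; its width is a
  power of \<open>n + 1\<close>, which the inner disc pays for only through a logarithm. The summand
  \<open>N\<^sup>2\<close> keeps \<open>A\<close> away from 0 at the zeros of \<open>f\<close>, so
  all its powers are smooth, and \<open>A \<ge> N\<^sup>2\<close> bounds the negative power
  \<open>A powr (1 - q)\<close> inside. The cap \<open>q \<le> 2\<close> fixes the sign of the
  remainder in the Laplacian of \<open>A powr (q/2)\<close>. Origin of the exponent
  \<open>q + 1\<close> of \<open>sqrt A\<close> on the ring: the sum over dyadic levels converges
  for exponents above 2, and the growth estimate leaves an integrable power of
  \<open>1 - |z|\<close> for exponents below \<open>2 * q\<close>. The midpoint is
  \<open>q + 1\<close>, and the range is nonempty exactly when \<open>q > 1\<close>. For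
  \<open>n \<rightarrow> 0\<close> the bound must vanish like \<open>sqrt n\<close>. Hence
  \<open>a\<close> is a power of \<open>n + 1\<close>, so that the inner disc shrinks to a point,
  and the factor \<open>n / (n + 1)\<close> is not estimated by 1.\<close>

lemma Basis_real2: "(Basis :: (real^2) set) = {axis 1 1, axis 2 1}"
  by (auto simp: Basis_vec_def UNIV_2)

text \<open>The change of variables in \<open>emeasure_image_complex\<close> comes from a theorem on
  matrix determinants over \<open>real^2\<close>; this identity carries it over to
  \<open>complex\<close>. Boxes suffice because they determine \<open>lborel\<close>.\<close>

lemma distr_lborel_real2_complex:
  "distr lborel borel (\<lambda>v::real^2. Complex (v $ 1) (v $ 2)) = lborel"
proof (rule lborel_eqI[symmetric])
  let ?e = "\<lambda>v::real^2. Complex (v $ 1) (v $ 2)"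
  have cont: "continuous_on UNIV ?e"
    by (simp add: Complex_eq continuous_intros)
  have [measurable]: "?e \<in> borel_measurable borel"
    using cont by (rule borel_measurable_continuous_onI)
  fix l u :: complex
  assume le: "\<And>b. b \<in> Basis \<Longrightarrow> l \<bullet> b \<le> u \<bullet> b"
  have le': "Re l \<le> Re u" "Im l \<le> Im u"
    using le[of 1] le[of \<i>] by (auto simp: Basis_complex_def inner_complex_def)
  define l' :: "real^2" where "l' = (\<chi> i. if i = 1 then Re l else Im l)"
  define u' :: "real^2" where "u' = (\<chi> i. if i = 1 then Re u else Im u)"
  have 21: "(2::2) \<noteq> 1" by simp
  have comp: "l' $ 1 = Re l" "l' $ 2 = Im l" "u' $ 1 = Re u" "u' $ 2 = Im u"
    using 21 by (simp_all add: l'_def u'_def)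
  have "?e -` box l u = box l' u'"
    by (auto simp: box_def Basis_real2 Basis_complex_def inner_complex_def inner_axis comp)
  then have "emeasure (distr lborel borel ?e) (box l u) = emeasure lborel (box l' u')"
    by (simp add: emeasure_distr)
  also have "\<dots> = ennreal (\<Prod>b\<in>Basis. (u' - l') \<bullet> b)"
    using le' by (intro emeasure_lborel_box) (auto simp: Basis_real2 inner_axis comp)
  also have "(\<Prod>b\<in>Basis. (u' - l') \<bullet> b) = (\<Prod>b\<in>Basis. (u - l) \<bullet> b)"
    using 21 by (simp add: Basis_real2 Basis_complex_def inner_axis inner_complex_def comp axis_eq_axis)
  finally show "emeasure (distr lborel borel ?e) (box l u) = ennreal (\<Prod>b\<in>Basis. (u - l) \<bullet> b)" .
qed simp

lemma borel_measurable_pair_Complex: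
  "(\<lambda>(x, y). Complex x y) \<in> borel_measurable (lborel \<Otimes>\<^sub>M lborel)"
proof -
  have "(\<lambda>p::real \<times> real. complex_of_real (fst p) + \<i> * complex_of_real (snd p)) \<in> borel_measurable borel"
    by (intro borel_measurable_continuous_onI continuous_intros)
  then show ?thesis
    by (simp add: Complex_eq case_prod_unfold lborel_prod)
qed

text \<open>The counterpart for a product of two lines, which makes Tonelli's theorem available in
  the coordinates \<open>Re\<close> and \<open>Im\<close>.\<close>

lemma distr_lborel_pair_complex:
  "distr (lborel \<Otimes>\<^sub>M lborel) borel (\<lambda>(x, y). Complex x y) = lborel"
proof (rule lborel_eqI[symmetric])
  let ?e = "\<lambda>(x::real, y::real). Complex x y"
  have [measurable]: "?e \<in> borel_measurable (lborel \<Otimes>\<^sub>M lborel)"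
    by (rule borel_measurable_pair_Complex)
  fix l u :: complex
  assume le: "\<And>b. b \<in> Basis \<Longrightarrow> l \<bullet> b \<le> u \<bullet> b"
  have le': "Re l \<le> Re u" "Im l \<le> Im u"
    using le[of 1] le[of \<i>] by (auto simp: Basis_complex_def inner_complex_def)
  have "?e -` box l u = box (Re l) (Re u) \<times> box (Im l) (Im u)"
    by (auto simp: box_def Basis_complex_def inner_complex_def)
  then have "emeasure (distr (lborel \<Otimes>\<^sub>M lborel) borel ?e) (box l u)
      = emeasure (lborel \<Otimes>\<^sub>M lborel) (box (Re l) (Re u) \<times> box (Im l) (Im u))"
    by (simp add: emeasure_distr space_pair_measure)
  also have "\<dots> = emeasure lborel (box (Re l) (Re u)) * emeasure lborel (box (Im l) (Im u))"
    by (rule lborel.emeasure_pair_measure_Times) auto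
  also have "\<dots> = ennreal (\<Prod>b\<in>Basis. (u - l) \<bullet> b)"
    using le' by (simp add: Basis_complex_def inner_complex_def ennreal_mult)
  finally show "emeasure (distr (lborel \<Otimes>\<^sub>M lborel) borel ?e) (box l u) = ennreal (\<Prod>b\<in>Basis. (u - l) \<bullet> b)" .
qed simp

lemma nn_integral_complex_iterated:
  assumes [measurable]: "h \<in> borel_measurable borel"
  shows "(\<integral>\<^sup>+z. h z \<partial>lborel) = (\<integral>\<^sup>+x. \<integral>\<^sup>+y. h (Complex x y) \<partial>lborel \<partial>lborel)"
proof -
  have [measurable]: "(\<lambda>(x, y). Complex x y) \<in> borel_measurable (lborel \<Otimes>\<^sub>M lborel)"
    by (rule borel_measurable_pair_Complex)
  have "(\<integral>\<^sup>+z. h z \<partial>lborel) = (\<integral>\<^sup>+p. h (case p of (x, y) \<Rightarrow> Complex x y) \<partial>(lborel \<Otimes>\<^sub>M lborel))"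
    by (subst distr_lborel_pair_complex[symmetric], subst nn_integral_distr) auto
  also have "\<dots> = (\<integral>\<^sup>+x. \<integral>\<^sup>+y. h (Complex x y) \<partial>lborel \<partial>lborel)"
    by (subst lborel.nn_integral_fst[symmetric]) auto
  finally show ?thesis .
qed

text \<open>\<open>J\<close> is kept apart from \<open>g'\<close> because \<open>g'\<close> is
  constrained only on \<open>S\<close>, whereas the integrand has to be Borel everywhere. The
  underlying theorem makes finite measure of the image equivalent to integrability of the Jacobian,
  so the two sides also become infinite together.\<close>

lemma emeasure_image_complex:
  fixes g :: "complex \<Rightarrow> complex"
  assumes S: "S \<in> sets borel"
    and der: "\<And>z. z \<in> S \<Longrightarrow> (g has_derivative g' z) (at z within S)"
    and inj: "inj_on g S" and im: "g ` S \<in> sets borel"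
    and J[measurable]: "J \<in> borel_measurable borel"
    and Jeq: "\<And>z. z \<in> S \<Longrightarrow> J z = \<bar>Re (g' z 1) * Im (g' z \<i>) - Re (g' z \<i>) * Im (g' z 1)\<bar>"
  shows "emeasure lborel (g ` S) = (\<integral>\<^sup>+z\<in>S. ennreal (J z) \<partial>lborel)"
proof -
  define e where "e = (\<lambda>v::real^2. Complex (v $ 1) (v $ 2))"
  define d :: "complex \<Rightarrow> real^2" where "d = (\<lambda>z. \<chi> i. if i = 1 then Re z else Im z)"
  have 21: "(2::2) \<noteq> 1" by simp
  have ed[simp]: "e (d z) = z" for z using 21 by (simp add: e_def d_def)
  have de[simp]: "d (e v) = v" for v
    using 21 by (simp add: e_def d_def vec_eq_iff forall_2)
  have bl_e: "bounded_linear e"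
    by (rule linear_conv_bounded_linear[THEN iffD1], rule linearI)
       (auto simp: e_def complex_eq_iff)
  have bl_d: "bounded_linear d"
    by (rule linear_conv_bounded_linear[THEN iffD1], rule linearI)
       (auto simp: d_def vec_eq_iff)
  have [measurable]: "e \<in> borel_measurable borel"
    by (intro borel_measurable_continuous_onI linear_continuous_on bl_e)
  define S2 where "S2 = e -` S"
  have S2[measurable]: "S2 \<in> sets borel"
    unfolding S2_def using S by (rule measurable_sets_borel[rotated]) simp
  define G where "G = d \<circ> g \<circ> e"
  define G' where "G' = (\<lambda>v. d \<circ> g' (e v) \<circ> e)"
  have eS2: "e ` S2 = S" unfolding S2_def by (metis ed surjI surj_image_vimage_eq)
  have derG: "(G has_derivative G' v) (at v within S2)" if "v \<in> S2" for v
  proof -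
    have 1: "(e has_derivative e) (at v within S2)"
      by (rule bounded_linear_imp_has_derivative[OF bl_e])
    have 2: "(g has_derivative g' (e v)) (at (e v) within (e ` S2))"
      unfolding eS2 using der that by (auto simp: S2_def)
    have 3: "(d has_derivative d) (at (g (e v)) within (g \<circ> e) ` S2)"
      by (rule bounded_linear_imp_has_derivative[OF bl_d])
    show ?thesis
      using diff_chain_within[OF diff_chain_within[OF 1 2], of d d] 3
      by (simp add: G_def G'_def o_assoc comp_def)
  qed
  have "inj_on G S2"
  proof (rule inj_onI)
    fix x y assume xy: "x \<in> S2" "y \<in> S2" "G x = G y"
    then have "g (e x) = g (e y)" unfolding G_def by (metis comp_apply ed)
    with inj xy have "e x = e y" by (auto simp: S2_def inj_on_def)
    then show "x = y" by (metis de)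
  qed
  have imG: "G ` S2 = e -` (g ` S)"
  proof -
    have "G ` S2 = d ` g ` S" unfolding G_def eS2[symmetric] by (simp add: image_image)
    also have "\<dots> = e -` (g ` S)" by (auto; metis de image_eqI)
    finally show ?thesis .
  qed
  have imGb: "G ` S2 \<in> sets borel"
    unfolding imG using im by (rule measurable_sets_borel[rotated]) simp
  have det: "\<bar>det (matrix (G' v))\<bar> = J (e v)" if "v \<in> S2" for v
  proof -
    have ax: "e (axis 1 1) = 1" "e (axis 2 1) = \<i>"
      by (auto simp: e_def axis_def complex_eq_iff)
    show ?thesis using that 21
      by (simp add: det_2 matrix_def G'_def ax Jeq S2_def d_def)
  qed
  have key: "G ` S2 \<in> lmeasurable \<and> measure lebesgue (G ` S2) = m
     \<longleftrightarrow> ((\<lambda>v. J (e v)) has_integral m) S2" for m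
  proof -
    have "S2 \<in> sets lebesgue" using S2 by simp
    from has_measure_differentiable_image[OF this derG \<open>inj_on G S2\<close>, of m]
    have "G ` S2 \<in> lmeasurable \<and> measure lebesgue (G ` S2) = m
      \<longleftrightarrow> ((\<lambda>x. \<bar>det (matrix (G' x))\<bar>) has_integral m) S2" by blast
    also have "\<dots> \<longleftrightarrow> ((\<lambda>v. J (e v)) has_integral m) S2"
      by (rule has_integral_cong) (rule det)
    finally show ?thesis .
  qed
  let ?H = "\<lambda>v. indicator S2 v * J (e v)"
  have Hnn: "0 \<le> ?H v" for v
    by (auto simp: indicator_def S2_def Jeq)
  have Hif: "?H = (\<lambda>v. if v \<in> S2 then J (e v) else 0)" by auto
  have D: "distr lborel borel e = lborel"
    unfolding e_def by (rule distr_lborel_real2_complex)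
  note S[measurable]
  have "(\<integral>\<^sup>+z\<in>S. ennreal (J z) \<partial>lborel) = (\<integral>\<^sup>+v. ennreal (J (e v)) * indicator S (e v) \<partial>lborel)"
    by (subst D[symmetric], subst nn_integral_distr) simp_all
  also have "\<dots> = (\<integral>\<^sup>+v. ennreal (?H v) \<partial>lborel)"
    by (intro nn_integral_cong) (auto simp: S2_def indicator_def)
  finally have I: "(\<integral>\<^sup>+z\<in>S. ennreal (J z) \<partial>lborel) = (\<integral>\<^sup>+v. ennreal (?H v) \<partial>lborel)" .
  have M: "emeasure lborel (g ` S) = emeasure lborel (G ` S2)"
    unfolding imG by (subst D[symmetric], subst emeasure_distr) (auto simp: im)
  have A: "emeasure lborel (G ` S2) = (\<integral>\<^sup>+v. ennreal (?H v) \<partial>lborel)" if lm: "G ` S2 \<in> lmeasurable"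
  proof -
    have "((\<lambda>v. J (e v)) has_integral measure lebesgue (G ` S2)) S2" using key lm by blast
    then have "(?H has_integral measure lebesgue (G ` S2)) UNIV"
      unfolding Hif has_integral_restrict_UNIV .
    then have "(\<integral>\<^sup>+v. ennreal (?H v) \<partial>lborel) = measure lebesgue (G ` S2)"
      by (intro nn_integral_has_integral_lborel Hnn) measurable
    also have "\<dots> = emeasure lebesgue (G ` S2)"
      using lm by (intro emeasure_eq_ennreal_measure[symmetric]) (auto simp: fmeasurable_def)
    finally show ?thesis using imGb by simp
  qed
  show ?thesis
  proof (cases "G ` S2 \<in> lmeasurable")
    case True
    then show ?thesis using A I M by simp
  next
    case False
    then have "emeasure lborel (G ` S2) = \<infinity>"
      using imGb by (auto simp: fmeasurable_def less_top[symmetric])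
    moreover have "(\<integral>\<^sup>+v. ennreal (?H v) \<partial>lborel) = \<infinity>"
    proof (rule ccontr)
      assume "\<not> ?thesis"
      then have "integrable lborel ?H"
        using Hnn by (intro integrableI_nonneg) (auto simp: top.not_eq_extremum)
      then have "(?H has_integral integral\<^sup>L lborel ?H) UNIV"
        by (rule has_integral_integral_lborel)
      then have "((\<lambda>v. J (e v)) has_integral integral\<^sup>L lborel ?H) S2"
        unfolding Hif has_integral_restrict_UNIV .
      with key False show False by blast
    qed
    ultimately show ?thesis using I M by simp
  qed
qed

lemma null_sets_real_axis: "{z. Im z = 0} \<in> null_sets lborel"
proof -
  have "negligible {z::complex. \<i> \<bullet> z = 0}"
    by (rule negligible_hyperplane) auto
  then have "{z. Im z = 0} \<in> null_sets lebesgue"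
    by (simp add: negligible_iff_null_sets inner_complex_def)
  moreover have "{z. Im z = 0} \<in> sets borel"
    by (intro borel_closed closed_Collect_eq continuous_intros)
  ultimately show ?thesis
    by (simp add: null_sets_completion_iff)
qed

text \<open>Polar coordinates are the planar map \<open>g\<close> on the half-strip
  \<open>S\<close>: its Jacobian is the radius \<open>Re z\<close>, it is injective, and its image
  misses only a half-line, which is a null set. The inequality comes from closing the angular
  interval; only upper bounds are drawn from it.\<close>

lemma nn_integral_polar_le:
  assumes h[measurable]: "h \<in> borel_measurable borel"
  shows "(\<integral>\<^sup>+z. h z \<partial>lborel)
    \<le> (\<integral>\<^sup>+r\<in>{0<..}. (\<integral>\<^sup>+t\<in>{0..2*pi}. h (of_real r * cis t) \<partial>lborel) * ennreal r \<partial>lborel)"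
proof -
  define g where "g = (\<lambda>z. of_real (Re z) * cis (Im z))"
  define S where "S = {z. 0 < Re z \<and> 0 < Im z \<and> Im z < 2 * pi}"
  have contg: "continuous_on UNIV g"
    unfolding g_def cis_conv_exp by (intro continuous_intros)
  have [measurable]: "g \<in> borel_measurable borel"
    using contg by (rule borel_measurable_continuous_onI)
  have "open S" unfolding S_def by (intro open_Collect_conj open_Collect_less continuous_intros)
  then have S[measurable]: "S \<in> sets borel" by simp
  have Re_m[measurable]: "Re \<in> borel_measurable borel"
    by (intro borel_measurable_continuous_onI continuous_intros)
  have inj: "inj_on g S"
  proof (rule inj_onI)
    fix z w assume zw: "z \<in> S" "w \<in> S" "g z = g w"
    have N: "Arg2pi (g z) = Im z" "norm (g z) = Re z" if "z \<in> S" for z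
      using that by (auto simp: g_def S_def norm_mult cis_conv_exp intro!: Arg2pi_unique)
    show "z = w" using N[OF zw(1)] N[OF zw(2)] unfolding zw(3) by (simp add: complex_eq_iff)
  qed
  have gS: "g ` S = - {z. Im z = 0 \<and> 0 \<le> Re z}"
  proof (intro equalityI subsetI)
    fix w assume "w \<in> g ` S"
    then obtain r t where rt: "w = of_real r * cis t" "0 < r" "0 < t" "t < 2 * pi"
      unfolding g_def S_def by blast
    show "w \<in> - {z. Im z = 0 \<and> 0 \<le> Re z}"
    proof
      assume "w \<in> {z. Im z = 0 \<and> 0 \<le> Re z}"
      then have *: "sin t = 0" "0 \<le> cos t" using rt by (auto simp: zero_le_mult_iff)
      then have "cos t = 1" using sin_cos_squared_add[of t] by (simp add: power2_eq_1_iff)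
      then have "cis t = 1" using *(1) by (simp add: complex_eq_iff)
      then have "Arg2pi 1 = t"
        using rt by (intro Arg2pi_unique[of 1]) (auto simp: cis_conv_exp)
      moreover have "Arg2pi 1 = 0" by (intro Arg2pi_unique[of 1]) auto
      ultimately show False using rt by simp
    qed
  next
    fix w assume w: "w \<in> - {z. Im z = 0 \<and> 0 \<le> Re z}"
    have "w = of_real (norm w) * cis (Arg2pi w)"
      using Arg2pi_eq[of w] by (simp add: cis_conv_exp)
    moreover have "0 \<noteq> Arg2pi w"
      using w Arg2pi_eq_0[of w] by (auto simp: complex_is_Real_iff)
    then have "0 < Arg2pi w" using Arg2pi_ge_0[of w] by linarith
    moreover have "w \<noteq> 0" using w by auto
    ultimately have "w = g (Complex (norm w) (Arg2pi w))" "Complex (norm w) (Arg2pi w) \<in> S"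
      using Arg2pi_lt_2pi[of w] by (auto simp: g_def S_def)
    then show "w \<in> g ` S" by blast
  qed
  have "closed {z. Im z = 0 \<and> 0 \<le> Re z}"
    by (intro closed_Collect_conj closed_Collect_eq closed_Collect_le continuous_intros)
  then have gSb: "g ` S \<in> sets borel" unfolding gS by simp
  define g' where "g' = (\<lambda>z v. of_real (Re v) * cis (Im z) + of_real (Re z) * (of_real (Im v) * (\<i> * cis (Im z))))"
  have der: "(g has_derivative g' z) (at z within T)" for z T
  proof -
    have re: "((\<lambda>z. complex_of_real (Re z)) has_derivative (\<lambda>v. of_real (Re v))) (at z within T)"
      by (intro bounded_linear_imp_has_derivative bounded_linear_compose[OF bounded_linear_of_real bounded_linear_Re])
    have "((\<lambda>z. \<i> * complex_of_real (Im z)) has_derivative (\<lambda>v. \<i> * of_real (Im v))) (at z within T)"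
      by (intro bounded_linear_imp_has_derivative bounded_linear_const_mult
          bounded_linear_compose[OF bounded_linear_of_real bounded_linear_Im])
    from has_derivative_compose[OF this DERIV_exp[unfolded has_field_derivative_def]]
    have "((\<lambda>z. exp (\<i> * complex_of_real (Im z))) has_derivative
        (\<lambda>v. exp (\<i> * of_real (Im z)) * (\<i> * of_real (Im v)))) (at z within T)" .
    from has_derivative_mult[OF re this] show ?thesis
      unfolding g_def g'_def cis_conv_exp
      by (rule has_derivative_eq_rhs) (auto simp: algebra_simps)
  qed
  have J: "\<bar>Re z\<bar> = \<bar>Re (g' z 1) * Im (g' z \<i>) - Re (g' z \<i>) * Im (g' z 1)\<bar>" for z
  proof -
    have "Re (g' z 1) * Im (g' z \<i>) - Re (g' z \<i>) * Im (g' z 1) = Re z * ((sin (Im z))\<^sup>2 + (cos (Im z))\<^sup>2)"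
      by (simp add: g'_def power2_eq_square algebra_simps del: sin_cos_squared_add3)
    then show ?thesis by simp
  qed
  \<comment> \<open>Comparing the two measures on Borel sets reduces the integral formula to
    measures of images, which \<open>emeasure_image_complex\<close> computes.\<close>
  let ?M = "distr (density lborel (\<lambda>z. indicator S z * ennreal \<bar>Re z\<bar>)) borel g"
  have "lborel = ?M"
  proof (rule measure_eqI)
    fix B :: "complex set" assume "B \<in> sets lborel"
    then have B[measurable]: "B \<in> sets borel" by simp
    have Bm: "g -` B \<in> sets borel" using B by (rule measurable_sets_borel[rotated]) simp
    have im: "g ` (S \<inter> g -` B) = B - {z. Im z = 0 \<and> 0 \<le> Re z}"
    proof -
      have "g ` (S \<inter> g -` B) = B \<inter> g ` S" by blast
      then show ?thesis unfolding gS by blast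
    qed
    have nul: "{z. Im z = 0 \<and> 0 \<le> Re z} \<in> null_sets lborel"
      using \<open>closed {z. Im z = 0 \<and> 0 \<le> Re z}\<close>
      by (intro null_sets_subset[OF null_sets_real_axis]) auto
    have "emeasure lborel B = emeasure lborel (g ` (S \<inter> g -` B))"
      unfolding im using B nul by (simp add: emeasure_Diff_null_set)
    also have "\<dots> = (\<integral>\<^sup>+z\<in>S \<inter> g -` B. ennreal \<bar>Re z\<bar> \<partial>lborel)"
    proof (rule emeasure_image_complex[OF _ der])
      show "g ` (S \<inter> g -` B) \<in> sets borel" unfolding im using gSb \<open>closed {z. Im z = 0 \<and> 0 \<le> Re z}\<close> by simp
      show "(\<lambda>z. \<bar>Re z\<bar>) \<in> borel_measurable borel" by measurable
      show "\<bar>Re z\<bar> = \<bar>Re (g' z 1) * Im (g' z \<i>) - Re (g' z \<i>) * Im (g' z 1)\<bar>" for z by (rule J)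
    qed (use Bm inj in \<open>auto intro: inj_on_subset\<close>)
    also have "\<dots> = emeasure ?M B"
      using Bm by (subst emeasure_distr, simp, simp, subst emeasure_density)
        (auto intro!: nn_integral_cong simp: indicator_def)
    finally show "emeasure lborel B = emeasure ?M B" .
  qed simp
  then have "(\<integral>\<^sup>+z. h z \<partial>lborel) = (\<integral>\<^sup>+z. h z \<partial>?M)" by simp
  also have "\<dots> = (\<integral>\<^sup>+z. indicator S z * ennreal \<bar>Re z\<bar> * h (g z) \<partial>lborel)"
    by (subst nn_integral_distr, simp, simp, subst nn_integral_density) simp_all
  also have "\<dots> = (\<integral>\<^sup>+r. \<integral>\<^sup>+t. indicator S (Complex r t) * ennreal \<bar>r\<bar> * h (g (Complex r t)) \<partial>lborel \<partial>lborel)"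
    by (subst nn_integral_complex_iterated) simp_all
  also have "\<dots> \<le> (\<integral>\<^sup>+r. \<integral>\<^sup>+t. (ennreal r * indicator {0<..} r) * (h (of_real r * cis t) * indicator {0..2*pi} t) \<partial>lborel \<partial>lborel)"
    by (intro nn_integral_mono) (auto simp: S_def indicator_def g_def mult_ac)
  also have "\<dots> = (\<integral>\<^sup>+r\<in>{0<..}. (\<integral>\<^sup>+t\<in>{0..2*pi}. h (of_real r * cis t) \<partial>lborel) * ennreal r \<partial>lborel)"
  proof (intro nn_integral_cong)
    fix r :: real
    have "(\<lambda>t. of_real r * cis t) \<in> borel_measurable borel"
      unfolding cis_conv_exp by (intro borel_measurable_continuous_onI continuous_intros)
    from measurable_compose[OF this h]
    have [measurable]: "(\<lambda>t. h (of_real r * cis t)) \<in> borel_measurable borel" .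
    show "(\<integral>\<^sup>+t. (ennreal r * indicator {0<..} r) * (h (of_real r * cis t) * indicator {0..2*pi} t) \<partial>lborel)
      = (\<integral>\<^sup>+t\<in>{0..2*pi}. h (of_real r * cis t) \<partial>lborel) * ennreal r * indicator {0<..} r"
      by (subst nn_integral_cmult, measurable, simp add: mult_ac)
  qed
  finally show ?thesis .
qed

subsection \<open>The area formula and mean valence\<close>

text \<open>Images of Borel sets are not Borel in general; here the image of \<open>A\<close> is a
  preimage under the holomorphic, hence continuous, inverse of \<open>f\<close>.\<close>

lemma borel_holomorphic_image:
  assumes "f holomorphic_on U" "open U" "inj_on f U" "A \<subseteq> U" "A \<in> sets borel"
  shows "f ` A \<in> sets borel"
proof -
  obtain g where g: "g holomorphic_on (f ` U)" "\<And>z. z \<in> U \<Longrightarrow> g (f z) = z"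
    using holomorphic_has_inverse[OF assms(1-3)] by metis
  have oU: "open (f ` U)" by (rule open_mapping_thm3[OF assms(1-3)])
  have "f ` A = g -` A \<inter> f ` U"
    using g(2) assms(4) by force
  moreover have "g -` A \<inter> f ` U \<in> sets borel"
  proof -
    have "(\<lambda>w. indicator (f ` U) w *\<^sub>R g w) \<in> borel_measurable borel"
      by (rule borel_measurable_continuous_on_indicator)
        (use oU g(1) in \<open>auto intro: holomorphic_on_imp_continuous_on\<close>)
    then have "(\<lambda>w. indicator (f ` U) w *\<^sub>R g w) -` A \<in> sets borel"
      using assms(5) by (rule measurable_sets_borel)
    moreover have "g -` A \<inter> f ` U = (\<lambda>w. indicator (f ` U) w *\<^sub>R g w) -` A \<inter> f ` U"
      by (auto simp: indicator_def)
    ultimately show ?thesis using oU by auto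
  qed
  ultimately show ?thesis by simp
qed

lemma borel_measurable_if_continuous_on:
  fixes h :: "'a::topological_space \<Rightarrow> 'b::real_normed_vector"
  assumes "A \<in> sets borel" "continuous_on A h"
  shows "(\<lambda>x. if x \<in> A then h x else 0) \<in> borel_measurable borel"
  using borel_measurable_continuous_on_indicator[OF assms]
  by (rule back_subst[of "\<lambda>g. g \<in> borel_measurable borel"]) auto

text \<open>By the Cauchy--Riemann equations the real Jacobian determinant of \<open>f\<close> is
  the squared modulus of its derivative.\<close>

lemma emeasure_holomorphic_image:
  assumes f: "f holomorphic_on U" "open U" "inj_on f U" and A: "A \<subseteq> U" "A \<in> sets borel"
  shows "emeasure lborel (f ` A) = (\<integral>\<^sup>+z\<in>A. ennreal ((norm (deriv f z))\<^sup>2) \<partial>lborel)"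
proof -
  let ?J = "\<lambda>z. (norm (if z \<in> U then deriv f z else 0))\<^sup>2"
  have [measurable]: "(\<lambda>z. if z \<in> U then deriv f z else 0) \<in> borel_measurable borel"
    by (rule borel_measurable_if_continuous_on)
      (use f in \<open>auto intro: holomorphic_on_imp_continuous_on holomorphic_deriv\<close>)
  have "emeasure lborel (f ` A) = (\<integral>\<^sup>+z\<in>A. ennreal (?J z) \<partial>lborel)"
  proof (rule emeasure_image_complex[where g' = "\<lambda>z. (*) (deriv f z)"])
    show "(f has_derivative (*) (deriv f z)) (at z within A)" if "z \<in> A" for z
      using holomorphic_derivI[OF f(1,2), of z] A that
      by (auto simp: has_field_derivative_def intro: has_derivative_at_withinI)
    show "?J z = \<bar>Re (deriv f z * 1) * Im (deriv f z * \<i>) - Re (deriv f z * \<i>) * Im (deriv f z * 1)\<bar>"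
      if "z \<in> A" for z
    proof -
      have "?J z = (Re (deriv f z))\<^sup>2 + (Im (deriv f z))\<^sup>2"
        using that A by (auto simp: cmod_power2)
      then show ?thesis by (simp add: power2_eq_square)
    qed
  qed (use A f borel_holomorphic_image[OF f A] in \<open>auto intro: inj_on_subset\<close>)
  also have "\<dots> = (\<integral>\<^sup>+z\<in>A. ennreal ((norm (deriv f z))\<^sup>2) \<partial>lborel)"
    using A by (intro nn_integral_cong) (auto simp: indicator_def)
  finally show ?thesis .
qed

lemma solution_mult_ge_1:
  assumes f: "f holomorphic_on U" "open U" "z \<in> U" and d: "deriv f z \<noteq> 0"
  shows "1 \<le> solution_mult f (f z) z"
proof -
  have fa: "(\<lambda>x. f x - f z) holomorphic_on U" by (intro holomorphic_intros f)
  have "deriv (\<lambda>x. f x - f z) z = deriv f z"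
    using holomorphic_on_imp_differentiable_at[OF f] by simp
  then have "zorder (\<lambda>x. f x - f z) z = 1"
    using d by (intro zorder_zero_eqI[OF fa f(2,3)]) simp_all
  then show ?thesis by (simp add: solution_mult_def)
qed

lemma card_le_solution_count:
  assumes f: "f holomorphic_on U" "open U"
    and Z: "finite Z" "Z \<subseteq> {z \<in> U. f z = w}" and d: "\<And>z. z \<in> Z \<Longrightarrow> deriv f z \<noteq> 0"
  shows "of_nat (card Z) \<le> solution_count f U w"
proof -
  have "of_nat (card Z) = (\<Sum>z\<in>Z. 1::ennreal)" by simp
  also have "\<dots> \<le> (\<Sum>z\<in>Z. solution_mult f w z)"
    using solution_mult_ge_1[OF f] Z d by (intro sum_mono) blast
  also have "\<dots> = (\<Sum>\<^sub>\<infinity>z\<in>Z. solution_mult f w z)"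
    using Z(1) by simp
  also have "\<dots> \<le> solution_count f U w"
    unfolding solution_count_def using Z
    by (intro infsum_mono_neutral) (auto intro: nonneg_summable_on_complete)
  finally show ?thesis .
qed

lemma holomorphic_multiplicity_lower_bound:
  assumes f: "f holomorphic_on U" "open U"
  obtains N where "N \<in> borel_measurable borel" "\<And>w. N w \<le> solution_count f U w"
    "\<And>B. B \<in> sets borel \<Longrightarrow>
      (\<integral>\<^sup>+z\<in>{z \<in> U. f z \<in> B}. ennreal ((norm (deriv f z))\<^sup>2) \<partial>lborel) = (\<integral>\<^sup>+w\<in>B. N w \<partial>lborel)"
proof -
  \<comment> \<open>Critical points contribute nothing to the left-hand integral; the rest of \<open>U\<close> is cut into
    countably many Borel pieces on which \<open>f\<close> is injective.\<close>
  define V where "V = {z \<in> U. deriv f z \<noteq> 0}"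
  have cont: "continuous_on U (deriv f)" "continuous_on U f"
    using f by (auto intro: holomorphic_on_imp_continuous_on holomorphic_deriv)
  define \<F> where "\<F> = {ball z r |z r. ball z r \<subseteq> U \<and> inj_on f (ball z r)}"
  obtain \<G> where G: "\<G> \<subseteq> \<F>" "countable \<G>" "\<Union>\<G> = \<Union>\<F>"
    using Lindelof[of \<F>] by (auto simp: \<F>_def)
  have VF: "V \<subseteq> \<Union>\<F>"
  proof
    fix z assume "z \<in> V"
    then obtain r where "r > 0" "ball z r \<subseteq> U" "inj_on f (ball z r)"
      using has_complex_derivative_locally_injective[OF f(1) _ f(2), of z] by (auto simp: V_def)
    then show "z \<in> \<Union>\<F>" unfolding \<F>_def by (auto intro!: exI[of _ "ball z r"])
  qed
  \<comment> \<open>The empty ball pads the family, so that \<open>from_nat_into\<close> enumerates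
    a nonempty set even if \<open>\<G>\<close> is empty.\<close>
  have "{} \<in> \<F>" unfolding \<F>_def by (auto intro!: exI[of _ 0])
  define W where "W = from_nat_into (insert {} \<G>)"
  have rW: "range W = insert {} \<G>"
    unfolding W_def using G(2) by (intro range_from_nat_into) auto
  have WF: "W i \<in> \<F>" for i 
  proof -
    have "W i \<in> insert {} \<G>" unfolding rW[symmetric] by simp
    then show ?thesis using G(1) \<open>{} \<in> \<F>\<close> by auto
  qed
  have W: "open (W i)" "W i \<subseteq> U" "inj_on f (W i)" for i
    using WF[of i] by (auto simp: \<F>_def)
  have holW: "f holomorphic_on W i" for i using f(1) W(2) by (rule holomorphic_on_subset)
  have "open V"
    unfolding V_def using continuous_open_preimage[OF cont(1) f(2), of "- {0}"]
    by (simp add: Int_def vimage_def open_Compl)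
  \<comment> \<open>Making the balls disjoint prevents double counting; the pieces need no longer be
    open, which is why Borel images are required.\<close>
  define A where "A i = disjointed W i \<inter> V" for i
  have AW: "A i \<subseteq> W i" for i unfolding A_def using disjointed_subset[of W i] by blast
  have A[measurable]: "A i \<in> sets borel" for i
  proof -
    have "disjointed W i \<in> sets borel"
      unfolding disjointed_def using W by (intro sets.Diff sets.finite_UN) auto
    then show ?thesis unfolding A_def using \<open>open V\<close> by auto
  qed
  have UA: "(\<Union>i. A i) = V"
    using VF G(3) rW UN_disjointed_eq[of W] by (auto simp: A_def)
  have disj: "disjoint_family A"
    using disjoint_family_disjointed[of W] unfolding A_def disjoint_family_on_def by blast
  have fA[measurable]: "f ` A i \<in> sets borel" for i
    by (rule borel_holomorphic_image[OF holW W(1,3) AW A])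
  \<comment> \<open>As \<open>f\<close> is injective on each piece and the pieces partition
    \<open>V\<close>, \<open>N w\<close> is the number of non-critical solutions of
    \<open>f z = w\<close>.\<close>
  define N :: "complex \<Rightarrow> ennreal" where "N w = (\<Sum>i. indicator (f ` A i) w)" for w
  have N[measurable]: "N \<in> borel_measurable borel" unfolding N_def by measurable
  moreover have "N w \<le> solution_count f U w" for w
  proof -
    have "(\<Sum>i<k. indicator (f ` A i) w) \<le> solution_count f U w" for k
    proof -
      define I where "I = {i. i < k \<and> w \<in> f ` A i}"
      \<comment> \<open>One solution is picked from each piece that contains one; disjointness keeps
        the choices distinct.\<close>
      have "\<forall>i\<in>I. \<exists>z. z \<in> A i \<and> f z = w" unfolding I_def by auto
      then obtain c where c: "\<And>i. i \<in> I \<Longrightarrow> c i \<in> A i \<and> f (c i) = w" by metis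
      have "inj_on c I"
      proof (rule inj_onI)
        fix i j assume ij: "i \<in> I" "j \<in> I" "c i = c j"
        then have "c i \<in> A i \<inter> A j" using c[of i] c[of j] by simp
        then show "i = j" using disj unfolding disjoint_family_on_def by blast
      qed
      have "(\<Sum>i<k. indicator (f ` A i) w :: ennreal) = of_nat (card I)"
        by (simp add: indicator_def I_def of_bool_def sum.If_cases Int_def)
      also have "\<dots> = of_nat (card (c ` I))" using \<open>inj_on c I\<close> by (simp add: card_image)
      also have "\<dots> \<le> solution_count f U w"
      proof (rule card_le_solution_count[OF f])
        show "finite (c ` I)" by (simp add: I_def)
        show "c ` I \<subseteq> {z \<in> U. f z = w}" using c AW W(2) by blast
        show "deriv f z \<noteq> 0" if "z \<in> c ` I" for z
          using that c unfolding A_def V_def by blast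
      qed
      finally show ?thesis .
    qed
    then show ?thesis unfolding N_def by (intro suminf_le_const) (auto simp: summableI)
  qed
  moreover have "(\<integral>\<^sup>+z\<in>{z \<in> U. f z \<in> B}. ennreal ((norm (deriv f z))\<^sup>2) \<partial>lborel) = (\<integral>\<^sup>+w\<in>B. N w \<partial>lborel)"
    if B[measurable]: "B \<in> sets borel" for B
  proof -
    define P where "P = {z \<in> U. f z \<in> B}"
    let ?h = "\<lambda>z. ennreal ((norm (if z \<in> U then deriv f z else 0))\<^sup>2)"
    have [measurable]: "(\<lambda>z. if z \<in> U then deriv f z else 0) \<in> borel_measurable borel"
      by (rule borel_measurable_if_continuous_on) (use f cont in auto)
    have [measurable]: "P \<in> sets borel"
    proof -
      have "(\<lambda>z. if z \<in> U then f z else 0) \<in> borel_measurable borel"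
        by (rule borel_measurable_if_continuous_on) (use f cont in auto)
      then have "(\<lambda>z. if z \<in> U then f z else 0) -` B \<in> sets borel"
        using B by (rule measurable_sets_borel)
      moreover have "P = (\<lambda>z. if z \<in> U then f z else 0) -` B \<inter> U"
        by (auto simp: P_def)
      ultimately show ?thesis using f(2) by auto
    qed
    have 1: "(\<integral>\<^sup>+w. indicator (f ` A i) w * indicator B w \<partial>lborel) = (\<integral>\<^sup>+z. ?h z * indicator (A i \<inter> P) z \<partial>lborel)" for i
    proof -
      have "(\<integral>\<^sup>+w. indicator (f ` A i) w * indicator B w \<partial>lborel) = (\<integral>\<^sup>+w. indicator (f ` A i \<inter> B) w \<partial>lborel)"
        by (simp add: indicator_inter_arith)
      also have "\<dots> = emeasure lborel (f ` A i \<inter> B)" by simp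
      also have "f ` A i \<inter> B = f ` (A i \<inter> P)"
        using AW W(2) by (fastforce simp: P_def)
      also have "emeasure lborel (f ` (A i \<inter> P)) = (\<integral>\<^sup>+z\<in>A i \<inter> P. ennreal ((norm (deriv f z))\<^sup>2) \<partial>lborel)"
        using AW by (intro emeasure_holomorphic_image[OF holW W(1,3)]) auto
      also have "\<dots> = (\<integral>\<^sup>+z. ?h z * indicator (A i \<inter> P) z \<partial>lborel)"
        by (intro nn_integral_cong) (auto simp: indicator_def P_def)
      finally show ?thesis .
    qed
    have "(\<integral>\<^sup>+w\<in>B. N w \<partial>lborel) = (\<integral>\<^sup>+w. (\<Sum>i. indicator (f ` A i) w * indicator B w) \<partial>lborel)"
      by (simp add: N_def)
    also have "\<dots> = (\<Sum>i. \<integral>\<^sup>+w. indicator (f ` A i) w * indicator B w \<partial>lborel)"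
      by (rule nn_integral_suminf) simp
    also have "\<dots> = (\<Sum>i. \<integral>\<^sup>+z. ?h z * indicator (A i \<inter> P) z \<partial>lborel)"
      by (simp add: 1)
    also have "\<dots> = (\<integral>\<^sup>+z. (\<Sum>i. ?h z * indicator (A i \<inter> P) z) \<partial>lborel)"
      by (rule nn_integral_suminf[symmetric]) simp
    also have "\<dots> = (\<integral>\<^sup>+z. ?h z * indicator (\<Union>i. A i \<inter> P) z \<partial>lborel)"
    proof (intro nn_integral_cong)
      fix z
      have "disjoint_family (\<lambda>i. A i \<inter> P)" using disj unfolding disjoint_family_on_def by blast
      then have "(\<Sum>i. indicator (A i \<inter> P) z :: ennreal) = indicator (\<Union>i. A i \<inter> P) z"
        by (rule suminf_indicator)
      then show "(\<Sum>i. ?h z * indicator (A i \<inter> P) z) = ?h z * indicator (\<Union>i. A i \<inter> P) z"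
        by simp
    qed
    also have "\<dots> = (\<integral>\<^sup>+z\<in>P. ennreal ((norm (deriv f z))\<^sup>2) \<partial>lborel)"
      using UA by (intro nn_integral_cong) (auto simp: indicator_def P_def V_def)
    finally show ?thesis unfolding P_def by simp
  qed
  ultimately show thesis by (rule that)
qed

text \<open>The definition of mean valence integrates \<open>solution_count\<close> itself, for
  which no measurability is proved. Polar coordinates are therefore applied to the Borel minorant
  \<open>N\<close>, and monotonicity of the nonnegative integral leads back to
  \<open>solution_count\<close>.\<close>

lemma mean_valent_on_area_le:
  assumes mv: "mean_valent_on n f G" and G: "open G" and R: "R > 0"
  shows "(\<integral>\<^sup>+z\<in>{z \<in> G. norm (f z) \<le> R}. ennreal ((norm (deriv f z))\<^sup>2) \<partial>lborel) \<le> ennreal (pi * n * R\<^sup>2)"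
proof -
  have f: "f holomorphic_on G" using mv by (simp add: mean_valent_on_def)
  obtain N where N[measurable]: "N \<in> borel_measurable borel" and Nle: "\<And>w. N w \<le> solution_count f G w"
    and Neq: "\<And>B. B \<in> sets borel \<Longrightarrow>
      (\<integral>\<^sup>+z\<in>{z \<in> G. f z \<in> B}. ennreal ((norm (deriv f z))\<^sup>2) \<partial>lborel) = (\<integral>\<^sup>+w\<in>B. N w \<partial>lborel)"
    using holomorphic_multiplicity_lower_bound[OF f G] by blast
  define X where "X = (\<integral>\<^sup>+r\<in>{0..R}. (\<integral>\<^sup>+t\<in>{0..2*pi}. solution_count f G (of_real r * cis t) \<partial>lborel) * ennreal r \<partial>lborel)"
  have eq: "(\<integral>\<^sup>+z\<in>{z \<in> G. norm (f z) \<le> R}. ennreal ((norm (deriv f z))\<^sup>2) \<partial>lborel)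
      = (\<integral>\<^sup>+w\<in>cball 0 R. N w \<partial>lborel)"
    using Neq[of "cball 0 R"] by simp
  have [measurable]: "cball (0::complex) R \<in> sets borel" by simp
  have "(\<integral>\<^sup>+w\<in>cball 0 R. N w \<partial>lborel)
      \<le> (\<integral>\<^sup>+r\<in>{0<..}. (\<integral>\<^sup>+t\<in>{0..2*pi}. N (of_real r * cis t) * indicator (cball 0 R) (of_real r * cis t) \<partial>lborel) * ennreal r \<partial>lborel)"
    by (intro nn_integral_polar_le) measurable
  also have "\<dots> \<le> X"
    unfolding X_def
  proof (intro nn_integral_mono)
    fix r :: real
    show "(\<integral>\<^sup>+t\<in>{0..2*pi}. N (of_real r * cis t) * indicator (cball 0 R) (of_real r * cis t) \<partial>lborel) * ennreal r * indicator {0<..} r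
      \<le> (\<integral>\<^sup>+t\<in>{0..2*pi}. solution_count f G (of_real r * cis t) \<partial>lborel) * ennreal r * indicator {0..R} r"
    proof (cases "r \<in> {0<..R}")
      case True
      then show ?thesis
        by (auto simp: indicator_def intro!: mult_right_mono nn_integral_mono Nle)
    next
      \<comment> \<open>For \<open>r > R\<close> the indicator of the disc makes the left side
        vanish, and for \<open>r \<le> 0\<close> the indicator of the half-line does.\<close>
      case False
      then show ?thesis by (cases "r > 0") (auto simp: indicator_def norm_mult)
    qed
  qed
  also have "X = ennreal pi * (ennreal (1 / pi) * X)"
    by (simp add: mult.assoc[symmetric] ennreal_mult[symmetric])
  also have "\<dots> \<le> ennreal pi * ennreal (n * R\<^sup>2)"
    using mv R unfolding mean_valent_on_def X_def by (intro mult_left_mono) auto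
  also have "\<dots> = ennreal (pi * n * R\<^sup>2)"
    by (subst ennreal_mult'[symmetric]) (simp_all add: mult_ac)
  finally show ?thesis unfolding eq .
qed

text \<open>For the least level \<open>k\<close> containing \<open>t\<close>, minimality gives
  \<open>t > 2 ^ k * N / 2\<close> if \<open>k > 0\<close>; at \<open>k = 0\<close> the summand
  \<open>N\<^sup>2\<close> supplies the lower bound for the base.\<close>

lemma powr_le_dyadic:
  fixes t N a :: real
  assumes N: "N > 0" and t: "t \<ge> 0" and a: "a > 0"
  obtains k :: nat where "t \<le> 2 ^ k * N" "(t\<^sup>2 + N\<^sup>2) powr (- a / 2) \<le> (2 ^ k * N / 2) powr - a"
proof -
  obtain m :: nat where "t / N < 2 ^ m" using real_arch_pow[of 2 "t / N"] by auto
  then have ex: "\<exists>m::nat. t \<le> 2 ^ m * N" using N by (auto simp: field_simps intro: less_imp_le)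
  define k :: nat where "k = (LEAST m. t \<le> 2 ^ m * N)"
  have k: "t \<le> 2 ^ k * N" unfolding k_def using ex by (rule LeastI_ex)
  have "(2 ^ k * N / 2)\<^sup>2 \<le> t\<^sup>2 + N\<^sup>2"
  proof (cases k)
    case 0
    have "(N / 2)\<^sup>2 \<le> N\<^sup>2" using N by (intro power_mono) auto
    then show ?thesis using 0 by (simp add: add_increasing)
  next
    case (Suc j)
    then have "\<not> t \<le> 2 ^ j * N" using not_less_Least[of j "\<lambda>m. t \<le> 2 ^ m * N"] by (simp add: k_def)
    then have "(2 ^ k * N / 2)\<^sup>2 \<le> t\<^sup>2" using Suc N by (intro power_mono) auto
    then show ?thesis by (simp add: add_increasing2)
  qed
  then have "(t\<^sup>2 + N\<^sup>2) powr (- a / 2) \<le> ((2 ^ k * N / 2)\<^sup>2) powr (- a / 2)"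
    using N a by (intro powr_mono2') auto
  also have "\<dots> = (2 ^ k * N / 2) powr - a"
  proof -
    have "(2 ^ k * N / 2)\<^sup>2 = (2 ^ k * N / 2) powr 2" using N by simp
    then show ?thesis by (simp only: powr_powr) simp
  qed
  finally show thesis using k that by blast
qed

text \<open>Charging each point to one dyadic level of \<open>norm (f z)\<close> produces a
  geometric series of ratio \<open>2 powr (1 - q)\<close>, convergent because \<open>q > 1\<close>.
  The sets \<open>P k\<close> are nested, not disjoint: this form is the one that
  \<open>mean_valent_on_area_le\<close> bounds, and counting a point several times only increases
  the upper bound.\<close>

lemma mean_valent_on_weighted_area_le:
  assumes mv: "mean_valent_on n f G" and G: "open G" and n: "n \<ge> 0" and N: "N > 0" and q: "q > 1"
  shows "(\<integral>\<^sup>+z\<in>G. ennreal ((norm (deriv f z))\<^sup>2 * ((norm (f z))\<^sup>2 + N\<^sup>2) powr (- (q + 1) / 2)) \<partial>lborel)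
    \<le> ennreal (4 * pi * n * (N / 2) powr (1 - q) / (1 - 2 powr (1 - q)))"
proof -
  have f: "f holomorphic_on G" using mv by (simp add: mean_valent_on_def)
  have cont: "continuous_on G (deriv f)" "continuous_on G f"
    using f G by (auto intro: holomorphic_on_imp_continuous_on holomorphic_deriv)
  define d where "d = (\<lambda>z. if z \<in> G then deriv f z else 0)"
  define F where "F = (\<lambda>z. if z \<in> G then f z else 0)"
  have [measurable]: "G \<in> sets borel" using G by simp
  have [measurable]: "d \<in> borel_measurable borel" "F \<in> borel_measurable borel"
    unfolding d_def F_def by (auto intro!: borel_measurable_if_continuous_on cont)
  define c where "c k = (2 ^ k * N / 2) powr - (q + 1)" for k :: nat
  have c0: "c k \<ge> 0" for k by (simp add: c_def)
  define P where "P k = {z \<in> G. norm (f z) \<le> 2 ^ k * N}" for k :: nat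
  have P[measurable]: "P k \<in> sets borel" for k
  proof -
    have "P k = {z. norm (F z) \<le> 2 ^ k * N} \<inter> G" by (auto simp: P_def F_def)
    then show ?thesis by simp
  qed
  let ?w = "\<lambda>z. ((norm (f z))\<^sup>2 + N\<^sup>2) powr (- (q + 1) / 2)"
  have pt: "ennreal ((norm (deriv f z))\<^sup>2 * ?w z) * indicator G z
      \<le> (\<Sum>k. ennreal (c k) * (ennreal ((norm (d z))\<^sup>2) * indicator (P k) z))" for z
  proof (cases "z \<in> G")
    case True
    obtain k :: nat where k: "norm (f z) \<le> 2 ^ k * N" "?w z \<le> c k"
      using powr_le_dyadic[OF N, of "norm (f z)" "q + 1"] q unfolding c_def by auto
    have "ennreal ((norm (deriv f z))\<^sup>2 * ?w z) * indicator G z \<le> ennreal (c k) * (ennreal ((norm (d z))\<^sup>2) * indicator (P k) z)"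
    proof -
      have "(norm (deriv f z))\<^sup>2 * ?w z \<le> c k * (norm (deriv f z))\<^sup>2"
        using mult_left_mono[OF k(2), of "(norm (deriv f z))\<^sup>2"] by (simp add: mult.commute)
      then show ?thesis
        using True k(1) c0 by (simp add: P_def d_def ennreal_mult[symmetric] ennreal_leI)
    qed
    also have "\<dots> \<le> (\<Sum>k. ennreal (c k) * (ennreal ((norm (d z))\<^sup>2) * indicator (P k) z))"
      using sum_le_suminf[of "\<lambda>k. ennreal (c k) * (ennreal ((norm (d z))\<^sup>2) * indicator (P k) z)" "{k}"]
      by (simp add: summableI)
    finally show ?thesis .
  qed simp
  have le_k: "ennreal (c k) * (\<integral>\<^sup>+z. ennreal ((norm (d z))\<^sup>2) * indicator (P k) z \<partial>lborel)
      \<le> ennreal (4 * pi * n * (N / 2) powr (1 - q) * (2 powr (1 - q)) ^ k)" for k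
  proof -
    have "(\<integral>\<^sup>+z. ennreal ((norm (d z))\<^sup>2) * indicator (P k) z \<partial>lborel)
        = (\<integral>\<^sup>+z\<in>P k. ennreal ((norm (deriv f z))\<^sup>2) \<partial>lborel)"
      by (intro nn_integral_cong) (auto simp: P_def d_def indicator_def)
    also have "\<dots> \<le> ennreal (pi * n * (2 ^ k * N)\<^sup>2)"
      unfolding P_def using N by (intro mean_valent_on_area_le[OF mv G]) auto
    finally have "ennreal (c k) * (\<integral>\<^sup>+z. ennreal ((norm (d z))\<^sup>2) * indicator (P k) z \<partial>lborel)
        \<le> ennreal (c k * (pi * n * (2 ^ k * N)\<^sup>2))"
      using n c0 by (subst ennreal_mult) (auto intro!: mult_left_mono)
    also have "c k * (pi * n * (2 ^ k * N)\<^sup>2) = 4 * pi * n * (N / 2) powr (1 - q) * (2 powr (1 - q)) ^ k"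
    proof -
      \<comment> \<open>In terms of the half-level \<open>x\<close> the area bound contains
        \<open>(2 * x)\<^sup>2\<close>, which explains the factor 4 and the \<open>N / 2\<close> of
        the conclusion.\<close>
      define x where "x = 2 ^ k * N / 2"
      have x: "x > 0" using N by (simp add: x_def)
      have "c k * (pi * n * (2 ^ k * N)\<^sup>2) = 4 * pi * n * (x powr - (q + 1) * x\<^sup>2)"
        by (simp add: c_def x_def power_divide)
      also have "x powr - (q + 1) * x\<^sup>2 = x powr (1 - q)"
        using x by (simp add: powr_add[symmetric] flip: powr_numeral)
      also have "x = 2 ^ k * (N / 2)" by (simp add: x_def)
      also have "\<dots> powr (1 - q) = (2 powr (1 - q)) ^ k * (N / 2) powr (1 - q)"
        using N by (subst powr_mult) (auto simp: powr_powr powr_power mult.commute simp flip: powr_realpow)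
      finally show ?thesis by (simp only: mult_ac)
    qed
    finally show ?thesis .
  qed
  have lt1: "2 powr (1 - q) < 1" using q powr_less_mono[of "1 - q" 0 "2::real"] by simp
  have "(\<integral>\<^sup>+z\<in>G. ennreal ((norm (deriv f z))\<^sup>2 * ?w z) \<partial>lborel)
      \<le> (\<integral>\<^sup>+z. (\<Sum>k. ennreal (c k) * (ennreal ((norm (d z))\<^sup>2) * indicator (P k) z)) \<partial>lborel)"
    by (intro nn_integral_mono pt)
  also have "\<dots> = (\<Sum>k. \<integral>\<^sup>+z. ennreal (c k) * (ennreal ((norm (d z))\<^sup>2) * indicator (P k) z) \<partial>lborel)"
    by (rule nn_integral_suminf) measurable
  also have "\<dots> = (\<Sum>k. ennreal (c k) * (\<integral>\<^sup>+z. ennreal ((norm (d z))\<^sup>2) * indicator (P k) z \<partial>lborel))"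
    by (intro suminf_cong nn_integral_cmult) measurable
  also have "\<dots> \<le> (\<Sum>k. ennreal (4 * pi * n * (N / 2) powr (1 - q) * (2 powr (1 - q)) ^ k))"
    by (intro suminf_le le_k) (auto simp: summableI)
  also have "\<dots> = ennreal (4 * pi * n * (N / 2) powr (1 - q) / (1 - 2 powr (1 - q)))"
    using n lt1 by (intro suminf_ennreal_eq)
      (use sums_mult[OF geometric_sums[of "2 powr (1 - q)"], of "4 * pi * n * (N / 2) powr (1 - q)"] in auto)
  finally show ?thesis .
qed

subsection \<open>Growth from circle means\<close>

lemma poisson_integral:
  assumes f: "f holomorphic_on ball 0 R" and \<rho>: "0 < \<rho>" "\<rho> < R" and z: "norm z < \<rho>"
  shows "((\<lambda>t. of_real ((\<rho>\<^sup>2 - (norm z)\<^sup>2) / (norm (of_real \<rho> * cis t - z))\<^sup>2) * f (of_real \<rho> * cis t))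
    has_integral (of_real (2 * pi) * f z)) {0..2*pi}"
proof -
  \<comment> \<open>Cauchy's formula for \<open>f\<close> times a factor that equals \<open>1\<close> at \<open>z\<close> and turns the Cauchy kernel
    into the Poisson kernel\<close>
  define h where "h = (\<lambda>u. f u * (of_real (\<rho>\<^sup>2 - (norm z)\<^sup>2) / (of_real (\<rho>\<^sup>2) - cnj z * u)))"
  have nz: "of_real (\<rho>\<^sup>2) - cnj z * u \<noteq> 0" if "norm u \<le> \<rho>" for u
  proof
    assume "of_real (\<rho>\<^sup>2) - cnj z * u = 0"
    then have "norm (complex_of_real (\<rho>\<^sup>2)) = norm (cnj z * u)" by simp
    then have "\<rho>\<^sup>2 = norm z * norm u" by (simp only: norm_of_real norm_mult complex_mod_cnj abs_power2)
    also have "\<dots> \<le> norm z * \<rho>" using that by (intro mult_left_mono) auto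
    also have "\<dots> < \<rho> * \<rho>" using z \<rho> by simp
    finally show False by (simp add: power2_eq_square)
  qed
  have hol: "f holomorphic_on cball 0 \<rho>"
    using f by (rule holomorphic_on_subset) (use \<rho> in auto)
  have hh: "h holomorphic_on cball 0 \<rho>"
    unfolding h_def by (intro holomorphic_intros hol) (use nz in auto)
  have hz: "h z = f z"
  proof -
    have "of_real (\<rho>\<^sup>2) - cnj z * z = of_real (\<rho>\<^sup>2 - (norm z)\<^sup>2)"
      using complex_norm_square[of z] by (simp add: mult.commute)
    moreover have "\<rho>\<^sup>2 - (norm z)\<^sup>2 \<noteq> 0"
      using z \<rho> power_strict_mono[of "norm z" \<rho> 2] by simp
    then have "complex_of_real (\<rho>\<^sup>2 - (norm z)\<^sup>2) \<noteq> 0" by (simp only: of_real_eq_0_iff) simp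
    ultimately show ?thesis by (simp add: h_def)
  qed
  have "((\<lambda>u. h u / (u - z)) has_contour_integral (2 * of_real pi * \<i> * h z)) (circlepath 0 \<rho>)"
    using z by (intro Cauchy_integral_circlepath)
      (auto intro: holomorphic_on_imp_continuous_on[OF hh] holomorphic_on_subset[OF hh])
  then have "((\<lambda>t. h (of_real \<rho> * cis t) / (of_real \<rho> * cis t - z) * of_real \<rho> * \<i> * cis t)
      has_integral (2 * of_real pi * \<i> * f z)) {0..2*pi}"
    unfolding circlepath_def by (subst (asm) has_contour_integral_part_circlepath_iff) (simp_all add: hz)
  from has_integral_mult_right[OF this, of "- \<i>"]
  have "((\<lambda>t. - \<i> * (h (of_real \<rho> * cis t) / (of_real \<rho> * cis t - z) * of_real \<rho> * \<i> * cis t))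
      has_integral (of_real (2 * pi) * f z)) {0..2*pi}" by (simp add: mult_ac)
  moreover have "- \<i> * (h (of_real \<rho> * cis t) / (of_real \<rho> * cis t - z) * of_real \<rho> * \<i> * cis t)
     = of_real ((\<rho>\<^sup>2 - (norm z)\<^sup>2) / (norm (of_real \<rho> * cis t - z))\<^sup>2) * f (of_real \<rho> * cis t)" for t
  proof -
    define w where "w = of_real \<rho> * cis t"
    have nw: "norm w = \<rho>" using \<rho> by (simp add: w_def norm_mult)
    then have w0: "w \<noteq> 0" "w \<noteq> z" using \<rho> z by auto
    have "of_real (\<rho>\<^sup>2) - cnj z * w = w * cnj (w - z)"
      using complex_norm_square[of w] nw by (simp add: algebra_simps)
    then have "- \<i> * (h w / (w - z) * \<i> * w) = f w * of_real (\<rho>\<^sup>2 - (norm z)\<^sup>2) / (cnj (w - z) * (w - z))"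
    proof -
      have *: "- \<i> * (a * (K / (b * d)) / e * \<i> * b) = a * K / (d * e)"
        if "b \<noteq> 0" "d \<noteq> 0" "e \<noteq> 0" for a b d e K :: complex
        using that by (simp add: field_simps)
      have "cnj (w - z) \<noteq> 0" "w - z \<noteq> 0" using w0(2) by (metis complex_cnj_zero_iff eq_iff_diff_eq_0)+
      then show ?thesis
        using *[OF w0(1)] \<open>of_real (\<rho>\<^sup>2) - cnj z * w = w * cnj (w - z)\<close> by (simp only: h_def)
    qed
    also have "\<dots> = of_real ((\<rho>\<^sup>2 - (norm z)\<^sup>2) / (norm (w - z))\<^sup>2) * f w"
      using complex_norm_square[of "w - z"] by (simp add: mult.commute)
    finally show ?thesis by (simp add: w_def mult_ac)
  qed
  ultimately show ?thesis by simp
qed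

text \<open>If \<open>x > A\<close>, then \<open>(x / A) powr (q - 1) \<ge> 1\<close>. Integrated
  against a kernel, with \<open>A\<close> still free, the inequality does the work of Hoelder's
  inequality.\<close>

lemma young_scaled:
  fixes x A q :: real
  assumes "x \<ge> 0" "A > 0" "q \<ge> 1"
  shows "x \<le> A + A powr (1 - q) * x powr q"
proof (cases "x \<le> A")
  case False
  then have "x powr (q - 1) \<ge> A powr (q - 1)" using assms by (intro powr_mono2) auto
  then have "x * A powr (q - 1) \<le> x * x powr (q - 1)" using assms by (intro mult_left_mono) auto
  also have "\<dots> = x powr q" using False assms by (simp add: powr_mult_base)
  finally have "A powr (1 - q) * (x * A powr (q - 1)) \<le> A powr (1 - q) * x powr q"
    by (intro mult_left_mono) auto
  also have "A powr (1 - q) * (x * A powr (q - 1)) = x"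
    using assms by (simp add: powr_add[symmetric] mult.left_commute)
  finally show ?thesis using assms by simp
qed (simp add: add_increasing2)

lemma continuous_on_circle:
  fixes g :: "complex \<Rightarrow> 'a::topological_space"
  assumes "continuous_on (ball 0 R) g" "0 \<le> s" "s < R"
  shows "continuous_on T (\<lambda>t. g (of_real s * cis t))"
  unfolding cis_conv_exp
  by (rule continuous_on_compose2[OF assms(1)]) (use assms in \<open>auto intro!: continuous_intros simp: norm_mult\<close>)

text \<open>On the circle of radius \<open>\<rho>\<close>, halfway between \<open>norm z\<close> and
  1, the Poisson kernel has total mass \<open>2 * pi\<close> and maximum at most
  \<open>4 / (1 - norm z)\<close>. After \<open>young_scaled\<close> the mass handles the constant
  summand and the maximum handles the \<open>q\<close>-th power.\<close>

lemma growth_of_circle_means: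
  assumes f: "f holomorphic_on ball 0 1" and N: "N > 0" and q: "q \<ge> 1"
    and mean: "\<And>s. 0 \<le> s \<Longrightarrow> s < 1 \<Longrightarrow> integral {0..2*pi} (\<lambda>t. norm (f (of_real s * cis t)) powr q) \<le> c * N powr q"
    and z: "norm z < 1"
  shows "norm (f z) \<le> (1 + 2 * c / pi) * N * (1 - norm z) powr (- 1 / q)"
proof -
  define \<rho> where "\<rho> = (1 + norm z) / 2"
  have \<rho>: "0 < \<rho>" "\<rho> < 1" "norm z < \<rho>" "\<rho> - norm z = (1 - norm z) / 2"
    using z norm_ge_zero[of z] unfolding \<rho>_def by (auto simp: field_simps simp del: norm_ge_zero)
  \<comment> \<open>This value balances the two summands:
    \<open>A powr (1 - q) / (1 - norm z) = A\<close>.\<close>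
  define A where "A = (1 - norm z) powr (- 1 / q)"
  have A: "A > 0" using z by (simp add: A_def)
  define P where "P t = (\<rho>\<^sup>2 - (norm z)\<^sup>2) / (norm (of_real \<rho> * cis t - z))\<^sup>2" for t
  have z2: "(norm z)\<^sup>2 < \<rho>\<^sup>2" using \<rho> by (intro power_strict_mono) auto
  have P0: "P t \<ge> 0" for t using z2 by (simp add: P_def)
  have Ple: "P t \<le> 4 / (1 - norm z)" for t
  proof -
    have "\<rho> - norm z \<le> norm (of_real \<rho> * cis t - z)"
      using norm_triangle_ineq2[of "of_real \<rho> * cis t" z] \<rho> by (simp add: norm_mult)
    then have "(\<rho> - norm z)\<^sup>2 \<le> (norm (of_real \<rho> * cis t - z))\<^sup>2"
      using \<rho> by (intro power_mono) auto
    then have "P t \<le> (\<rho>\<^sup>2 - (norm z)\<^sup>2) / (\<rho> - norm z)\<^sup>2"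
      unfolding P_def using z2 \<rho>(3) by (intro divide_left_mono mult_pos_pos) auto
    also have "\<dots> = (\<rho> + norm z) / (\<rho> - norm z)"
      using \<rho>(3) by (simp add: power2_eq_square square_diff_square_factored)
    also have "\<dots> \<le> 2 / (\<rho> - norm z)"
      using \<rho> z by (intro divide_right_mono) auto
    finally show ?thesis using \<rho>(4) by simp
  qed
  have intP: "(P has_integral 2 * pi) {0..2*pi}"
  proof -
    have "((\<lambda>t. complex_of_real (P t)) has_integral of_real (2 * pi)) {0..2*pi}"
      using poisson_integral[of "\<lambda>_. 1" 1 \<rho> z] \<rho> by (simp add: P_def)
    from has_integral_linear[OF this bounded_linear_Re] show ?thesis by (simp add: o_def)
  qed
  have cf: "continuous_on {0..2*pi} (\<lambda>t. f (of_real \<rho> * cis t))"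
    using \<rho> f by (intro continuous_on_circle[of 1] holomorphic_on_imp_continuous_on) auto
  let ?g = "\<lambda>t. norm (f (of_real \<rho> * cis t)) powr q"
  have int2: "?g integrable_on {0..2*pi}"
    using q by (intro integrable_continuous_interval continuous_on_powr' continuous_on_norm cf continuous_on_const) auto
  have I2: "((\<lambda>t. A * N * P t + 4 / (1 - norm z) * (N * A powr (1 - q) * N powr - q) * ?g t)
      has_integral A * N * (2 * pi) + 4 / (1 - norm z) * (N * A powr (1 - q) * N powr - q) * integral {0..2*pi} ?g) {0..2*pi}"
    using int2 by (intro has_integral_add has_integral_mult_right intP) (simp add: integrable_integral)
  have I1: "((\<lambda>t. of_real (P t) * f (of_real \<rho> * cis t)) has_integral (of_real (2 * pi) * f z)) {0..2*pi}"
    unfolding P_def using poisson_integral[OF f] \<rho> by simp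
  have "norm (of_real (2 * pi) * f z) \<le> A * N * (2 * pi) + 4 / (1 - norm z) * (N * A powr (1 - q) * N powr - q) * integral {0..2*pi} ?g"
    unfolding integral_unique[OF I1, symmetric] integral_unique[OF I2, symmetric]
  proof (rule integral_norm_bound_integral)
    fix t
    let ?y = "norm (f (of_real \<rho> * cis t))"
    have "?y / N \<le> A + A powr (1 - q) * (?y / N) powr q"
      using N A q by (intro young_scaled) auto
    then have "?y \<le> N * (A + A powr (1 - q) * (?y / N) powr q)"
      using N by (simp add: field_simps)
    also have "\<dots> = A * N + N * A powr (1 - q) * N powr - q * ?y powr q"
      using N by (simp add: powr_divide powr_minus field_simps)
    finally have "P t * ?y \<le> P t * (A * N + N * A powr (1 - q) * N powr - q * ?y powr q)"
      using P0 by (rule mult_left_mono)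
    also have "\<dots> = A * N * P t + P t * (N * A powr (1 - q) * N powr - q * ?y powr q)"
      by (simp add: algebra_simps)
    also have "P t * (N * A powr (1 - q) * N powr - q * ?y powr q)
        \<le> 4 / (1 - norm z) * (N * A powr (1 - q) * N powr - q * ?y powr q)"
      using N by (intro mult_right_mono Ple) auto
    finally show "norm (of_real (P t) * f (of_real \<rho> * cis t))
        \<le> A * N * P t + 4 / (1 - norm z) * (N * A powr (1 - q) * N powr - q) * ?g t"
      using P0[of t] by (simp add: norm_mult mult_ac)
  qed (use I1 I2 in \<open>auto simp: integrable_on_def\<close>)
  also have "\<dots> \<le> A * N * (2 * pi) + 4 / (1 - norm z) * (N * A powr (1 - q) * N powr - q) * (c * N powr q)"
    using \<rho> z N by (intro add_left_mono mult_left_mono mean) auto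
  also have "\<dots> = A * N * (2 * pi) + 4 * c * N * (A powr (1 - q) / (1 - norm z))"
  proof -
    have "N powr - q * N powr q = 1" using N by (simp add: powr_minus)
    then have "4 / (1 - norm z) * (N * A powr (1 - q) * N powr - q) * (c * N powr q)
        = 4 / (1 - norm z) * (N * A powr (1 - q)) * c"
      by (metis (no_types, opaque_lifting) mult.assoc mult.left_commute mult.right_neutral)
    then show ?thesis by simp
  qed
  also have "A powr (1 - q) / (1 - norm z) = A"
  proof -
    have "A powr (1 - q) = (1 - norm z) powr ((- 1 / q) * (1 - q))" by (simp add: A_def powr_powr)
    also have "(- 1 / q) * (1 - q) = 1 + (- 1 / q)" using q by (simp add: field_simps)
    also have "(1 - norm z) powr \<dots> = (1 - norm z) * A" unfolding powr_add A_def using z by simp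
    finally show ?thesis using z by simp
  qed
  also have "A * N * (2 * pi) + 4 * c * N * A = 2 * pi * ((1 + 2 * c / pi) * N * A)"
    by (simp add: field_simps)
  finally have "2 * pi * norm (f z) \<le> 2 * pi * ((1 + 2 * c / pi) * N * A)"
    by (simp add: norm_mult)
  then show ?thesis by (simp add: A_def)
qed

subsection \<open>The Hardy--Stein inequality\<close>

lemma continuous_on_circle_integral:
  fixes g :: "complex \<Rightarrow> real"
  assumes g: "continuous_on (ball 0 1) g"
  shows "continuous_on {0..<1} (\<lambda>s. integral {0..2*pi} (\<lambda>t. g (of_real s * cis t)))"
proof -
  have "continuous_on ({0..<1} \<times> cbox 0 (2*pi)) (\<lambda>(s, t). g (of_real s * cis t))"
    unfolding case_prod_unfold cis_conv_exp
    by (rule continuous_on_compose2[OF g]) (auto intro!: continuous_intros simp: norm_mult)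
  from integral_continuous_on_param[OF this] show ?thesis by simp
qed

text \<open>A function that is not integrable has integral 0 by convention, so the sign needs no
  integrability proof.\<close>

lemma integral_nonneg_total:
  fixes f :: "'a::euclidean_space \<Rightarrow> real"
  assumes "\<And>x. x \<in> S \<Longrightarrow> 0 \<le> f x"
  shows "0 \<le> integral S f"
  using assms integral_nonneg not_integrable_integral[of f S] by (cases "f integrable_on S") auto

text \<open>Because \<open>N \<noteq> 0\<close>, the base stays positive at the zeros of
  \<open>\<gamma>\<close>, and the power is differentiable there for every real
  \<open>a\<close>.\<close>

lemma has_real_derivative_norm_powr:
  fixes \<gamma> :: "real \<Rightarrow> complex"
  assumes d: "(\<gamma> has_vector_derivative d) (at \<tau>)" and N: "N \<noteq> 0"
  shows "((\<lambda>\<tau>. ((norm (\<gamma> \<tau>))\<^sup>2 + N\<^sup>2) powr a) has_real_derivative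
    2 * a * ((norm (\<gamma> \<tau>))\<^sup>2 + N\<^sup>2) powr (a - 1) * Re (cnj (\<gamma> \<tau>) * d)) (at \<tau>)"
proof -
  have "((\<lambda>\<tau>. Re (\<gamma> \<tau>)) has_real_derivative Re d) (at \<tau>)" "((\<lambda>\<tau>. Im (\<gamma> \<tau>)) has_real_derivative Im d) (at \<tau>)"
    unfolding has_real_derivative_iff_has_vector_derivative
    using bounded_linear.has_vector_derivative[OF bounded_linear_Re d]
      bounded_linear.has_vector_derivative[OF bounded_linear_Im d] by auto
  moreover have "((\<lambda>\<tau>. (u \<tau>)\<^sup>2 + (v \<tau>)\<^sup>2 + N\<^sup>2) has_real_derivative 2 * (u \<tau> * u' + v \<tau> * v')) (at \<tau>)"
    if "(u has_real_derivative u') (at \<tau>)" "(v has_real_derivative v') (at \<tau>)" for u v :: "real \<Rightarrow> real" and u' v'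
    using that by (auto intro!: derivative_eq_intros)
  ultimately have "((\<lambda>\<tau>. (Re (\<gamma> \<tau>))\<^sup>2 + (Im (\<gamma> \<tau>))\<^sup>2 + N\<^sup>2) has_real_derivative
      2 * Re (cnj (\<gamma> \<tau>) * d)) (at \<tau>)" by fastforce
  then have "((\<lambda>\<tau>. (norm (\<gamma> \<tau>))\<^sup>2 + N\<^sup>2) has_real_derivative 2 * Re (cnj (\<gamma> \<tau>) * d)) (at \<tau>)"
    by (simp add: cmod_power2)
  moreover have "(norm (\<gamma> \<tau>))\<^sup>2 + N\<^sup>2 > 0" using N by (simp add: add_nonneg_pos)
  ultimately show ?thesis
    using DERIV_fun_powr[of "\<lambda>\<tau>. (norm (\<gamma> \<tau>))\<^sup>2 + N\<^sup>2" "2 * Re (cnj (\<gamma> \<tau>) * d)" \<tau> a]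
    by (auto elim!: DERIV_cong simp: algebra_simps)
qed

lemma has_real_derivative_Re_cnj_mult:
  fixes \<gamma> \<beta> :: "real \<Rightarrow> complex"
  assumes "(\<gamma> has_vector_derivative d) (at \<tau>)" "(\<beta> has_vector_derivative e) (at \<tau>)"
  shows "((\<lambda>\<tau>. Re (cnj (\<gamma> \<tau>) * \<beta> \<tau>)) has_real_derivative Re (cnj d * \<beta> \<tau>) + Re (cnj (\<gamma> \<tau>) * e)) (at \<tau>)"
proof -
  have "((\<lambda>\<tau>. cnj (\<gamma> \<tau>)) has_vector_derivative cnj d) (at \<tau>)"
    by (rule bounded_linear.has_vector_derivative[OF bounded_linear_cnj assms(1)])
  from has_vector_derivative_mult[OF this assms(2)]
  have "((\<lambda>\<tau>. cnj (\<gamma> \<tau>) * \<beta> \<tau>) has_vector_derivative cnj (\<gamma> \<tau>) * e + cnj d * \<beta> \<tau>) (at \<tau>)" .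
  from bounded_linear.has_vector_derivative[OF bounded_linear_Re this]
  show ?thesis unfolding has_real_derivative_iff_has_vector_derivative by (simp add: add.commute)
qed

text \<open>A convex function with negative slope at \<open>a\<close> lies above its tangent there,
  which rises without bound to the left.\<close>

lemma nonneg_deriv_of_bounded_convex:
  fixes m m' m'' :: "real \<Rightarrow> real"
  assumes d1: "\<And>x. x < 0 \<Longrightarrow> (m has_real_derivative m' x) (at x)"
    and d2: "\<And>x. x < 0 \<Longrightarrow> (m' has_real_derivative m'' x) (at x)"
    and conv: "\<And>x. x < 0 \<Longrightarrow> 0 \<le> m'' x"
    and bd: "\<And>x. x < 0 \<Longrightarrow> 0 \<le> m x \<and> m x \<le> M" and a: "a < 0"
  shows "0 \<le> m' a"
proof (rule ccontr)
  assume "\<not> 0 \<le> m' a"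
  then have neg: "m' a < 0" by simp
  have M: "0 \<le> M" using bd[OF a] by simp
  \<comment> \<open>Far enough to the left for the tangent at \<open>a\<close> to have risen by
    \<open>M + 1\<close>, which exceeds the bound \<open>M\<close>.\<close>
  define x where "x = a - (M + 1) / (- m' a)"
  have xa: "x < a" using neg M by (simp add: x_def divide_neg_neg field_simps)
  obtain \<xi> where \<xi>: "\<xi> > x" "\<xi> < a" "m a - m x = (a - x) * m' \<xi>"
    using MVT2[OF xa, of m m'] d1 a by auto
  have "m' \<xi> \<le> m' a"
  proof (rule DERIV_nonneg_imp_nondecreasing[of \<xi> a m'])
    fix y assume "\<xi> \<le> y" "y \<le> a"
    then show "\<exists>d. (m' has_real_derivative d) (at y) \<and> 0 \<le> d" using a d2[of y] conv[of y] by auto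
  qed (use \<xi> in simp)
  then have "(a - x) * m' \<xi> \<le> (a - x) * m' a" using xa by (intro mult_left_mono) auto
  also have "(a - x) * m' a = - (M + 1)" using neg by (simp add: x_def field_simps)
  finally have "m x \<ge> m a + M + 1" using \<xi>(3) by simp
  then show False using bd[of x] bd[OF a] xa a by simp
qed

text \<open>The right-hand side is the Laplacian of \<open>A powr (q / 2)\<close>, written as the
  sum of the second derivatives in the directions 1 and \<open>\<i>\<close>. The terms with
  \<open>w\<close> cancel, the squared first derivatives add up to
  \<open>(norm u)\<^sup>2 * (norm v)\<^sup>2\<close>, and the excess over the left-hand side is
  \<open>q * (2 - q) * A powr (q / 2 - 2) * (norm v)\<^sup>2 * (A - (norm
  u)\<^sup>2)\<close>.\<close>

lemma hardy_stein_laplacian_ge: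
  fixes A q :: real and u v :: complex
  assumes q: "0 \<le> q" "q \<le> 2" and A: "(norm u)\<^sup>2 \<le> A" "A > 0"
  shows "q\<^sup>2 * (A powr (q / 2 - 1) * (norm v)\<^sup>2)
    \<le> (q * (q - 2) * A powr (q / 2 - 2) * (Re (cnj u * v))\<^sup>2 + q * A powr (q / 2 - 1) * ((norm v)\<^sup>2 + Re (cnj u * w)))
     + (q * (q - 2) * A powr (q / 2 - 2) * (Re (cnj u * (\<i> * v)))\<^sup>2 + q * A powr (q / 2 - 1) * ((norm v)\<^sup>2 - Re (cnj u * w)))"
proof -
  have 1: "A powr (q / 2 - 1) = A * A powr (q / 2 - 2)"
    using A powr_add[of A 1 "q / 2 - 2"] by simp
  have 2: "(Re (cnj u * v))\<^sup>2 + (Re (cnj u * (\<i> * v)))\<^sup>2 = (norm u)\<^sup>2 * (norm v)\<^sup>2"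
    unfolding cmod_power2 by (simp add: power2_eq_square algebra_simps)
  have id: "(q * (q - 2) * P * X + q * (A * P) * (b + R)) + (q * (q - 2) * P * Y + q * (A * P) * (b - R))
      = q\<^sup>2 * (A * P * b) + q * (2 - q) * P * b * (A - a)" if "X + Y = a * b" for a b P R X Y :: real
  proof -
    have "Y = a * b - X" using that by simp
    show ?thesis unfolding \<open>Y = a * b - X\<close> by (simp add: algebra_simps power2_eq_square)
  qed
  have "0 \<le> q * (2 - q) * A powr (q / 2 - 2) * (norm v)\<^sup>2 * (A - (norm u)\<^sup>2)"
    using q A by (intro mult_nonneg_nonneg) auto
  then show ?thesis
    unfolding 1 id[OF 2] by simp
qed

lemma hardy_stein:
  assumes f: "f holomorphic_on ball 0 1" and N: "N > 0" and q: "0 < q" "q \<le> 2"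
    and mean: "\<And>s. 0 \<le> s \<Longrightarrow> s < 1 \<Longrightarrow>
      integral {0..2*pi} (\<lambda>t. ((norm (f (of_real s * cis t)))\<^sup>2 + N\<^sup>2) powr (q / 2)) \<le> M"
    and \<delta>: "0 < \<delta>" "\<delta> \<le> \<rho>" "\<rho> < 1"
  shows "integral {\<delta>..\<rho>} (\<lambda>s. (\<rho> - s) * s * integral {0..2*pi} (\<lambda>t. (norm (deriv f (of_real s * cis t)))\<^sup>2 *
      ((norm (f (of_real s * cis t)))\<^sup>2 + N\<^sup>2) powr (q / 2 - 1))) \<le> \<rho> * M / q\<^sup>2"
proof -
  \<comment> \<open>In the coordinate \<open>\<zeta> = x + i t = ln z\<close> the angular second derivative integrates to zero over a
    period, so the mean \<open>m\<close> satisfies \<open>m'' = \<integral> \<Delta>V\<close>; it is convex and bounded as \<open>x \<rightarrow> -\<infinity>\<close>,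
    hence increasing.\<close>
  define H where "H = {\<zeta>. Re \<zeta> < 0}"
  define F where "F = (\<lambda>\<zeta>. f (exp \<zeta>))"
  define F1 where "F1 = (\<lambda>\<zeta>. deriv f (exp \<zeta>) * exp \<zeta>)"
  define F2 where "F2 = (\<lambda>\<zeta>. (deriv (deriv f) (exp \<zeta>) * exp \<zeta>) * exp \<zeta> + deriv f (exp \<zeta>) * exp \<zeta>)"
  have expH: "exp \<zeta> \<in> ball 0 1" if "\<zeta> \<in> H" for \<zeta> using that by (simp add: H_def)
  have f1: "deriv f holomorphic_on ball 0 1" using f by (intro holomorphic_deriv) auto
  have dF: "(F has_field_derivative F1 \<zeta>) (at \<zeta>)" if "\<zeta> \<in> H" for \<zeta>
    unfolding F_def F1_def
    using DERIV_chain2[OF holomorphic_derivI[OF f open_ball expH[OF that]] DERIV_exp] by simp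
  have dF1: "(F1 has_field_derivative F2 \<zeta>) (at \<zeta>)" if "\<zeta> \<in> H" for \<zeta>
  proof -
    have "((\<lambda>\<zeta>. deriv f (exp \<zeta>)) has_field_derivative (deriv (deriv f) (exp \<zeta>) * exp \<zeta>)) (at \<zeta>)"
      using DERIV_chain2[OF holomorphic_derivI[OF f1 open_ball expH[OF that]] DERIV_exp] by simp
    from DERIV_mult[OF this DERIV_exp] show ?thesis
      unfolding F1_def F2_def by (simp add: add.commute mult.commute)
  qed
  have contF: "continuous_on H F" using dF by (meson DERIV_isCont continuous_at_imp_continuous_on)
  have contF1: "continuous_on H F1" using dF1 by (meson DERIV_isCont continuous_at_imp_continuous_on)
  have contF2: "continuous_on H F2"
  proof -
    have "deriv (deriv f) holomorphic_on ball 0 1" using f1 by (rule holomorphic_deriv) simp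
    moreover have compH: "continuous_on H (\<lambda>\<zeta>. g (exp \<zeta>))" if "g holomorphic_on ball 0 1" for g :: "complex \<Rightarrow> complex"
      by (rule continuous_on_compose2[OF holomorphic_on_imp_continuous_on[OF that]])
        (use expH in \<open>auto intro!: continuous_intros\<close>)
    ultimately show ?thesis unfolding F2_def
      by (intro continuous_intros compH f1)
  qed
  define A where "A = (\<lambda>\<zeta>. (norm (F \<zeta>))\<^sup>2 + N\<^sup>2)"
  have A: "A \<zeta> > 0" for \<zeta> using N by (simp add: A_def add_nonneg_pos)
  have contA: "continuous_on H A" unfolding A_def by (intro continuous_intros contF)
  define V where "V = (\<lambda>\<zeta>. A \<zeta> powr (q / 2))"
  \<comment> \<open>\<open>V1 c\<close> and \<open>V2 c\<close> are the first and second derivatives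
    of \<open>V\<close> in the direction \<open>c\<close>: radial for \<open>c = 1\<close>, angular
    for \<open>c = \<i>\<close>.\<close>
  define V1 where "V1 = (\<lambda>c \<zeta>. q * A \<zeta> powr (q / 2 - 1) * Re (cnj (F \<zeta>) * (c * F1 \<zeta>)))"
  define V2 where "V2 = (\<lambda>c \<zeta>. q * (q - 2) * A \<zeta> powr (q / 2 - 2) * (Re (cnj (F \<zeta>) * (c * F1 \<zeta>)))\<^sup>2
     + q * A \<zeta> powr (q / 2 - 1) * ((norm (c * F1 \<zeta>))\<^sup>2 + Re (cnj (F \<zeta>) * (c * c * F2 \<zeta>))))"
  have contV: "continuous_on H V" "continuous_on H (V1 c)" "continuous_on H (V2 c)" for c
    unfolding V_def V1_def V2_def
    by (intro continuous_intros contA contF contF1 contF2; use A less_imp_neq in fastforce)+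
  have lineF: "((\<lambda>\<tau>. F (\<zeta> + c * of_real \<tau>)) has_vector_derivative c * F1 (\<zeta> + c * of_real \<tau>)) (at \<tau>)"
    and lineF1: "((\<lambda>\<tau>. c * F1 (\<zeta> + c * of_real \<tau>)) has_vector_derivative c * c * F2 (\<zeta> + c * of_real \<tau>)) (at \<tau>)"
    if "\<zeta> + c * of_real \<tau> \<in> H" for \<zeta> c \<tau>
  proof -
    have l: "((\<lambda>\<tau>. \<zeta> + c * of_real \<tau>) has_vector_derivative c) (at \<tau>)"
      by (auto intro!: derivative_eq_intros has_vector_derivative_real_field)
    show "((\<lambda>\<tau>. F (\<zeta> + c * of_real \<tau>)) has_vector_derivative c * F1 (\<zeta> + c * of_real \<tau>)) (at \<tau>)"
      using field_vector_diff_chain_at[OF l dF[OF that]] by (simp add: o_def)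
    have "((\<lambda>\<tau>. F1 (\<zeta> + c * of_real \<tau>)) has_vector_derivative c * F2 (\<zeta> + c * of_real \<tau>)) (at \<tau>)"
      using field_vector_diff_chain_at[OF l dF1[OF that]] by (simp add: o_def)
    from has_vector_derivative_mult_right[OF this, of c]
    show "((\<lambda>\<tau>. c * F1 (\<zeta> + c * of_real \<tau>)) has_vector_derivative c * c * F2 (\<zeta> + c * of_real \<tau>)) (at \<tau>)"
      by (simp add: mult.assoc)
  qed
  have dV: "((\<lambda>\<tau>. V (\<zeta> + c * of_real \<tau>)) has_real_derivative V1 c (\<zeta> + c * of_real \<tau>)) (at \<tau>)"
    if "\<zeta> + c * of_real \<tau> \<in> H" for \<zeta> c \<tau>
    using has_real_derivative_norm_powr[OF lineF[OF that], of N "q / 2"] N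
    by (simp add: V_def V1_def A_def)
  have dV1: "((\<lambda>\<tau>. V1 c (\<zeta> + c * of_real \<tau>)) has_real_derivative V2 c (\<zeta> + c * of_real \<tau>)) (at \<tau>)"
    if "\<zeta> + c * of_real \<tau> \<in> H" for \<zeta> c \<tau>
  proof -
    have e: "Re (cnj x * x) = (norm x)\<^sup>2" for x
      unfolding cmod_power2 by (simp add: power2_eq_square)
    have x: "q / 2 - 1 - 1 = q / 2 - 2" by simp
    note d1 = has_real_derivative_norm_powr[OF lineF[OF that], of N "q / 2 - 1", unfolded x]
    note d2 = has_real_derivative_Re_cnj_mult[OF lineF[OF that] lineF1[OF that], unfolded e]
    show ?thesis
      unfolding V1_def V2_def
      using DERIV_mult[OF DERIV_cmult[OF d1, of q] d2] N
      by (auto simp: A_def power2_eq_square algebra_simps elim!: DERIV_cong)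
  qed
  have V2_ge: "q\<^sup>2 * (A \<zeta> powr (q / 2 - 1) * (norm (F1 \<zeta>))\<^sup>2) \<le> V2 1 \<zeta> + V2 \<i> \<zeta>" for \<zeta>
  proof -
    have e: "norm (\<i> * F1 \<zeta>) = norm (F1 \<zeta>)" "1 * F1 \<zeta> = F1 \<zeta>" "1 * 1 * F2 \<zeta> = F2 \<zeta>"
      "Re (cnj (F \<zeta>) * (\<i> * \<i> * F2 \<zeta>)) = - Re (cnj (F \<zeta>) * F2 \<zeta>)"
      by (simp_all add: norm_mult)
    show ?thesis
      unfolding V2_def e add_uminus_conv_diff
      by (rule hardy_stein_laplacian_ge) (use q A in \<open>auto simp: A_def\<close>)
  qed
  define m where "m x = integral {0..2*pi} (\<lambda>t. V (of_real x + \<i> * of_real t))" for x :: real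
  define m1 where "m1 x = integral {0..2*pi} (\<lambda>t. V1 1 (of_real x + \<i> * of_real t))" for x :: real
  define m2 where "m2 x = integral {0..2*pi} (\<lambda>t. V2 1 (of_real x + \<i> * of_real t))" for x :: real
  have inH: "of_real x + \<i> * of_real t \<in> H" if "x < 0" for x t :: real using that by (simp add: H_def)
  have cont2: "continuous_on ({..<0} \<times> T) (\<lambda>(x, t). g (of_real x + \<i> * of_real t))"
    if "continuous_on H g" for g :: "complex \<Rightarrow> real" and T
    unfolding case_prod_unfold
    by (rule continuous_on_compose2[OF that]) (use inH in \<open>auto intro!: continuous_intros\<close>)
  have cont1: "continuous_on T (\<lambda>t. g (of_real x + \<i> * of_real t))"
    if "continuous_on H g" "x < 0" for g :: "complex \<Rightarrow> real" and x T
    by (rule continuous_on_compose2[OF that(1)]) (use inH that in \<open>auto intro!: continuous_intros\<close>)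
  \<comment> \<open>The factor \<open>1\<close> in \<open>d\<close> is the direction
    \<open>c\<close>, so that \<open>dV\<close> and \<open>dV1\<close> can be inserted as they
    stand.\<close>
  have leib: "((\<lambda>x. integral {0..2*pi} (\<lambda>t. g (of_real x + \<i> * of_real t))) has_real_derivative
      integral {0..2*pi} (\<lambda>t. g' (of_real x + \<i> * of_real t))) (at x)"
    if "continuous_on H g" "continuous_on H g'" "x < 0"
      and d: "\<And>\<zeta> \<tau>. \<zeta> + 1 * of_real \<tau> \<in> H \<Longrightarrow>
        ((\<lambda>\<tau>. g (\<zeta> + 1 * of_real \<tau>)) has_real_derivative g' (\<zeta> + 1 * of_real \<tau>)) (at \<tau>)"
    for g g' :: "complex \<Rightarrow> real" and x
  proof -
    have "((\<lambda>x. integral (cbox 0 (2*pi)) (\<lambda>t. g (of_real x + \<i> * of_real t))) has_real_derivative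
      integral (cbox 0 (2*pi)) (\<lambda>t. g' (of_real x + \<i> * of_real t))) (at x within {..<0})"
    proof (rule leibniz_rule_field_derivative)
      fix x t :: real assume "x \<in> {..<0}"
      then show "((\<lambda>x. g (of_real x + \<i> * of_real t)) has_real_derivative g' (of_real x + \<i> * of_real t)) (at x within {..<0})"
        using d[of "\<i> * of_real t" x] inH[of x t]
        by (auto simp: add.commute intro: has_field_derivative_at_within)
    next
      show "(\<lambda>t. g (of_real x + \<i> * of_real t)) integrable_on cbox 0 (2 * pi)" if "x \<in> {..<0}" for x
        using that \<open>continuous_on H g\<close> by (intro integrable_continuous cont1) auto
    qed (use that cont2 in auto)
    then show ?thesis using \<open>x < 0\<close> by (simp add: at_within_open[of x "{..<0}"])
  qed
  have dm: "(m has_real_derivative m1 x) (at x)" if "x < 0" for x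
    unfolding m_def m1_def by (rule leib[OF contV(1) contV(2) that dV])
  have dm1: "(m1 has_real_derivative m2 x) (at x)" if "x < 0" for x
    unfolding m1_def m2_def by (rule leib[OF contV(2) contV(3) that dV1])
  define \<Lambda> where "\<Lambda> s = integral {0..2*pi} (\<lambda>t. (norm (deriv f (of_real s * cis t)))\<^sup>2 *
      ((norm (f (of_real s * cis t)))\<^sup>2 + N\<^sup>2) powr (q / 2 - 1))" for s
  have polar: "exp (of_real (ln s) + \<i> * of_real t) = of_real s * cis t" if "0 < s" for s t
    using that by (simp add: exp_add cis_conv_exp exp_of_real flip: of_real_exp)
  \<comment> \<open>The chain rule gives \<open>F1\<close> a factor \<open>exp \<zeta>\<close> of
    modulus \<open>s\<close>; this is the source of \<open>s\<^sup>2\<close>.\<close>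
  have m2_ge: "q\<^sup>2 * (s\<^sup>2 * \<Lambda> s) \<le> m2 (ln s)" if s: "0 < s" "s < 1" for s
  proof -
    let ?z = "\<lambda>t. of_real (ln s) + \<i> * of_real t"
    have ls: "ln s < 0" using s by simp
    have I0: "((\<lambda>t. V2 \<i> (?z t)) has_integral 0) {0..2*pi}"
    proof -
      have "((\<lambda>t. V2 \<i> (?z t)) has_integral V1 \<i> (?z (2*pi)) - V1 \<i> (?z 0)) {0..2*pi}"
        using dV1 inH[OF ls] 
        by (intro fundamental_theorem_of_calculus)
           (auto simp: has_real_derivative_iff_has_vector_derivative intro: has_vector_derivative_at_within)
      moreover have "exp (?z (2*pi)) = exp (?z 0)"
        unfolding polar[OF s(1)] by simp
      then have "V1 \<i> (?z (2*pi)) = V1 \<i> (?z 0)"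
        unfolding V1_def A_def F_def F1_def by (simp only:)
      ultimately show ?thesis by simp
    qed
    have I1: "((\<lambda>t. V2 1 (?z t)) has_integral m2 (ln s)) {0..2*pi}"
      unfolding m2_def by (intro integrable_integral integrable_continuous_interval cont1 contV ls)
    have I2: "((\<lambda>t. q\<^sup>2 * (s\<^sup>2 * ((norm (deriv f (of_real s * cis t)))\<^sup>2 *
      ((norm (f (of_real s * cis t)))\<^sup>2 + N\<^sup>2) powr (q / 2 - 1)))) has_integral q\<^sup>2 * (s\<^sup>2 * \<Lambda> s)) {0..2*pi}"
      unfolding \<Lambda>_def using s f f1 N
      by (intro has_integral_mult_right integrable_integral integrable_continuous_interval
          continuous_intros continuous_on_circle[of 1] holomorphic_on_imp_continuous_on)
         (auto simp: add_nonneg_eq_0_iff)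
    have "q\<^sup>2 * (s\<^sup>2 * \<Lambda> s) \<le> m2 (ln s) + 0"
    proof (rule has_integral_le[OF I2 has_integral_add[OF I1 I0]])
      fix t
      have nF1: "(norm (F1 (?z t)))\<^sup>2 = s\<^sup>2 * (norm (deriv f (of_real s * cis t)))\<^sup>2"
        unfolding F1_def polar[OF s(1)] using s by (simp add: norm_mult power_mult_distrib)
      have FA: "A (?z t) = (norm (f (of_real s * cis t)))\<^sup>2 + N\<^sup>2"
        unfolding A_def F_def polar[OF s(1)] ..
      have "q\<^sup>2 * (A (?z t) powr (q / 2 - 1) * (norm (F1 (?z t)))\<^sup>2) \<le> V2 1 (?z t) + V2 \<i> (?z t)"
        by (rule V2_ge)
      then show "q\<^sup>2 * (s\<^sup>2 * ((norm (deriv f (of_real s * cis t)))\<^sup>2 *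
        ((norm (f (of_real s * cis t)))\<^sup>2 + N\<^sup>2) powr (q / 2 - 1))) \<le> V2 1 (?z t) + V2 \<i> (?z t)"
        unfolding FA nF1 by (simp only: mult_ac)
    qed
    then show ?thesis by simp
  qed
  have \<Lambda>0: "\<Lambda> s \<ge> 0" for s unfolding \<Lambda>_def by (intro integral_nonneg_total) auto
  have m_eq: "m (ln s) = integral {0..2*pi} (\<lambda>t. ((norm (f (of_real s * cis t)))\<^sup>2 + N\<^sup>2) powr (q / 2))" if "0 < s" for s
    unfolding m_def V_def A_def F_def polar[OF that] ..
  have m_bd: "0 \<le> m x \<and> m x \<le> M" if "x < 0" for x
    using m_eq[of "exp x"] mean[of "exp x"] that
    by (auto simp: m_def V_def intro!: integral_nonneg_total)
  have m2_0: "0 \<le> m2 x" if "x < 0" for x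
    using m2_ge[of "exp x"] that \<Lambda>0[of "exp x"]
    by (auto intro: order_trans[rotated])
  have m1_0: "0 \<le> m1 x" if "x < 0" for x
    by (rule nonneg_deriv_of_bounded_convex[OF dm dm1 m2_0 m_bd that])
  \<comment> \<open>Integration by parts in the variable \<open>ln s\<close>: the \<open>m1\<close>
    terms cancel in the derivative of \<open>h\<close>. At \<open>\<rho>\<close> the first summand
    is 0, so \<open>h \<rho> \<le> M\<close>; at \<open>\<delta>\<close> the sign of
    \<open>m1\<close> yields \<open>h \<delta> \<ge> 0\<close>, and the estimate becomes independent
    of \<open>\<delta>\<close>.\<close>
  define h where "h s = (ln \<rho> - ln s) * m1 (ln s) + m (ln s)" for s
  have dh: "(h has_real_derivative (ln \<rho> - ln s) * (m2 (ln s) / s)) (at s)" if "0 < s" "s < 1" for s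
  proof -
    have l: "(ln has_real_derivative 1 / s) (at s)" using that by (auto intro!: derivative_eq_intros)
    have ls: "ln s < 0" using that by simp
    have "((\<lambda>s. m1 (ln s)) has_real_derivative m2 (ln s) * (1 / s)) (at s)"
      by (rule DERIV_chain2[OF dm1[OF ls] l])
    moreover have "((\<lambda>s. m (ln s)) has_real_derivative m1 (ln s) * (1 / s)) (at s)"
      by (rule DERIV_chain2[OF dm[OF ls] l])
    ultimately show ?thesis
      unfolding h_def using that by (auto intro!: derivative_eq_intros)
  qed
  have "integral {\<delta>..\<rho>} (\<lambda>s. (\<rho> - s) * s * \<Lambda> s) \<le> \<rho> / q\<^sup>2 * (h \<rho> - h \<delta>)"
  proof (rule has_integral_le)
    have "continuous_on {0..<1} \<Lambda>"
      unfolding \<Lambda>_def using f f1 N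
      by (intro continuous_on_circle_integral continuous_intros holomorphic_on_imp_continuous_on)
        (auto simp: add_nonneg_eq_0_iff)
    then have "continuous_on {\<delta>..\<rho>} \<Lambda>" by (rule continuous_on_subset) (use \<delta> in auto)
    then show "((\<lambda>s. (\<rho> - s) * s * \<Lambda> s) has_integral integral {\<delta>..\<rho>} (\<lambda>s. (\<rho> - s) * s * \<Lambda> s)) {\<delta>..\<rho>}"
      by (intro integrable_integral integrable_continuous_interval continuous_intros)
    have "((\<lambda>s. (ln \<rho> - ln s) * (m2 (ln s) / s)) has_integral (h \<rho> - h \<delta>)) {\<delta>..\<rho>}"
      using \<delta> dh by (intro fundamental_theorem_of_calculus)
       (auto simp: has_real_derivative_iff_has_vector_derivative intro: has_vector_derivative_at_within)
    then show "((\<lambda>s. \<rho> / q\<^sup>2 * ((ln \<rho> - ln s) * (m2 (ln s) / s))) has_integral \<rho> / q\<^sup>2 * (h \<rho> - h \<delta>)) {\<delta>..\<rho>}"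
      by (rule has_integral_mult_right)
    fix s assume s: "s \<in> {\<delta>..\<rho>}"
    then have s': "0 < s" "s < 1" "s \<le> \<rho>" using \<delta> by auto
    \<comment> \<open>The linear weight of the conclusion is, up to the factor
      \<open>\<rho>\<close>, a lower bound for the logarithmic weight that the integration by parts
      produces.\<close>
    have "ln (s / \<rho>) \<le> s / \<rho> - 1" using s' by (intro ln_le_minus_one) simp
    then have l: "(\<rho> - s) / \<rho> \<le> ln \<rho> - ln s" using s' by (simp add: ln_div diff_divide_distrib)
    have "(\<rho> - s) / \<rho> * (q\<^sup>2 * (s\<^sup>2 * \<Lambda> s) / s) \<le> (ln \<rho> - ln s) * (m2 (ln s) / s)"
      using s' \<Lambda>0[of s] by (intro mult_mono l divide_right_mono m2_ge) auto
    then have "\<rho> / q\<^sup>2 * ((\<rho> - s) / \<rho> * (q\<^sup>2 * (s\<^sup>2 * \<Lambda> s) / s)) \<le> \<rho> / q\<^sup>2 * ((ln \<rho> - ln s) * (m2 (ln s) / s))"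
      using s' by (intro mult_left_mono) auto
    moreover have "\<rho> / q\<^sup>2 * ((\<rho> - s) / \<rho> * (q\<^sup>2 * (s\<^sup>2 * \<Lambda> s) / s)) = (\<rho> - s) * s * \<Lambda> s"
      using s' q by (simp add: power2_eq_square)
    ultimately show "(\<rho> - s) * s * \<Lambda> s \<le> \<rho> / q\<^sup>2 * ((ln \<rho> - ln s) * (m2 (ln s) / s))"
      by simp
  qed
  also have "\<dots> \<le> \<rho> / q\<^sup>2 * M"
  proof (rule mult_left_mono)
    have "h \<rho> \<le> M" using m_bd[of "ln \<rho>"] \<delta> by (simp add: h_def)
    moreover have "0 \<le> h \<delta>"
      using m_bd[of "ln \<delta>"] m1_0[of "ln \<delta>"] \<delta> by (simp add: h_def)
    ultimately show "h \<rho> - h \<delta> \<le> M" by simp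
  qed (use \<delta> in auto)
  finally show ?thesis by (simp add: \<Lambda>_def)
qed

subsection \<open>Estimates on the inner disc and the outer ring\<close>

lemma nn_integral_continuous_interval:
  fixes g :: "real \<Rightarrow> real"
  assumes g: "continuous_on {a..b} g" "\<And>x. x \<in> {a..b} \<Longrightarrow> 0 \<le> g x"
  shows "(\<integral>\<^sup>+x\<in>{a..b}. ennreal (g x) \<partial>lborel) = ennreal (integral {a..b} g)"
proof -
  let ?h = "\<lambda>x. if x \<in> {a..b} then g x else 0"
  have "?h \<in> borel_measurable borel" using g by (intro borel_measurable_if_continuous_on) auto
  moreover have "(?h has_integral integral {a..b} g) UNIV"
    unfolding has_integral_restrict_UNIV
    by (intro integrable_integral integrable_continuous_interval g)
  ultimately have "(\<integral>\<^sup>+x. ennreal (?h x) \<partial>lborel) = ennreal (integral {a..b} g)"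
    using g by (intro nn_integral_has_integral_lborel) auto
  also have "(\<integral>\<^sup>+x. ennreal (?h x) \<partial>lborel) = (\<integral>\<^sup>+x\<in>{a..b}. ennreal (g x) \<partial>lborel)"
    by (intro nn_integral_cong) (simp add: indicator_def)
  finally show ?thesis by simp
qed

text \<open>This lets \<open>\<delta>\<close> tend to 0 in \<open>hardy_stein\<close>. It is
  continuity from below of the measure with density \<open>g\<close>, along the intervals that start
  at \<open>b / (k + 1)\<close>.\<close>

lemma nn_integral_greaterThanAtMost_le:
  fixes g :: "real \<Rightarrow> real"
  assumes g: "continuous_on {0<..b} g" "\<And>x. x \<in> {0<..b} \<Longrightarrow> 0 \<le> g x" and b: "0 < b"
    and le: "\<And>\<delta>. 0 < \<delta> \<Longrightarrow> \<delta> \<le> b \<Longrightarrow> integral {\<delta>..b} g \<le> C"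
  shows "(\<integral>\<^sup>+x\<in>{0<..b}. ennreal (g x) \<partial>lborel) \<le> ennreal C"
proof -
  let ?h = "\<lambda>x. if x \<in> {0<..b} then g x else 0"
  have h[measurable]: "?h \<in> borel_measurable borel" using g by (intro borel_measurable_if_continuous_on) auto
  define M where "M = density lborel (\<lambda>x. ennreal (?h x))"
  define S where "S k = {b / real (Suc k)..b}" for k
  have Sub: "S k \<subseteq> {0<..b}" for k
  proof -
    have "0 < b / real (Suc k)" using b by simp
    then show ?thesis by (auto simp: S_def)
  qed
  have emb: "emeasure M T = (\<integral>\<^sup>+x\<in>T. ennreal (g x) \<partial>lborel)" if T: "T \<subseteq> {0<..b}" "T \<in> sets borel" for T
  proof -
    have "(\<lambda>x. ennreal (?h x)) \<in> borel_measurable lborel" using h by measurable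
    then show ?thesis
      unfolding M_def using T
      by (subst emeasure_density) (auto intro!: nn_integral_cong simp: indicator_def simp del: greaterThanAtMost_iff)
  qed
  have UN: "(\<Union>k. S k) = {0<..b}"
  proof
    show "{0<..b} \<subseteq> (\<Union>k. S k)"
    proof
      fix x assume x: "x \<in> {0<..b}"
      obtain k where "b / x < real k" using reals_Archimedean2 by blast
      then have "b / real (Suc k) \<le> x" using x by (simp add: field_simps)
      then show "x \<in> (\<Union>k. S k)" using x by (auto simp: S_def)
    qed
  qed (use Sub in blast)
  have "incseq S"
    unfolding incseq_def
  proof (intro allI impI)
    fix i j :: nat assume "i \<le> j"
    then have "b / real (Suc j) \<le> b / real (Suc i)" using b by (intro divide_left_mono) auto
    then show "S i \<subseteq> S j" by (auto simp: S_def simp del: of_nat_Suc)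
  qed
  have "(\<integral>\<^sup>+x\<in>{0<..b}. ennreal (g x) \<partial>lborel) = emeasure M (\<Union>k. S k)"
    unfolding UN by (rule emb[symmetric]) auto
  also have "\<dots> = (SUP k. emeasure M (S k))"
    by (rule SUP_emeasure_incseq[symmetric, OF _ \<open>incseq S\<close>]) (auto simp: S_def M_def)
  also have "\<dots> \<le> ennreal C"
  proof (rule SUP_least)
    fix k
    have "emeasure M (S k) = (\<integral>\<^sup>+x\<in>S k. ennreal (g x) \<partial>lborel)" by (rule emb[OF Sub]) (simp add: S_def)
    also have "\<dots> = ennreal (integral (S k) g)"
      unfolding S_def using g Sub[of k]
      by (intro nn_integral_continuous_interval) (auto simp: S_def intro: continuous_on_subset)
    also have "\<dots> \<le> ennreal C"
      unfolding S_def using b by (intro ennreal_leI le) (auto simp: field_simps)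
    finally show "emeasure M (S k) \<le> ennreal C" .
  qed
  finally show ?thesis .
qed

lemma ennreal_linear_combination:
  assumes "0 \<le> a" "0 \<le> b" "0 \<le> x" "0 \<le> y"
  shows "ennreal (a * x + b * y) = ennreal a * ennreal x + ennreal b * ennreal y"
  using assms by (simp add: ennreal_mult)

text \<open>The expansion of \<open>(\<kappa> * w * x - 1)\<^sup>2 \<ge> 0\<close>. Integrated, with
  \<open>\<kappa>\<close> chosen at the end, it takes the part of Cauchy--Schwarz; being pointwise,
  it allows the two resulting integrals to be enlarged to different sets.\<close>

lemma weighted_am_gm:
  fixes x w \<kappa> :: real
  assumes "\<kappa> > 0" "w > 0"
  shows "x \<le> \<kappa> / 2 * (x\<^sup>2 * w) + 1 / (2 * \<kappa>) * (1 / w)"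
proof -
  have "0 \<le> (\<kappa> * w * x - 1)\<^sup>2" by simp
  then have "2 * (\<kappa> * w * x) \<le> \<kappa> * w * (\<kappa> * w * x\<^sup>2) + 1"
    by (simp add: power2_eq_square algebra_simps)
  then have "x \<le> (\<kappa> * w * (\<kappa> * w * x\<^sup>2) + 1) / (2 * (\<kappa> * w))"
    using assms by (simp add: pos_le_divide_eq mult_ac)
  also have "\<dots> = \<kappa> / 2 * (x\<^sup>2 * w) + 1 / (2 * \<kappa>) * (1 / w)"
    using assms by (simp add: field_simps)
  finally show ?thesis .
qed

text \<open>With the weight \<open>(\<rho> - s) * A powr (q / 2 - 1)\<close> in
  \<open>weighted_am_gm\<close>, the first term is the integral in \<open>hardy_stein\<close>, and
  the second is a circle mean divided by \<open>\<rho> - s\<close>, the source of the logarithm.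
  Stopping at \<open>r < \<rho>\<close> keeps that logarithm finite.\<close>

lemma integral_deriv_inner_disc_le:
  assumes f: "f holomorphic_on ball 0 1" and N: "N > 0" and q: "1 < q" "q \<le> 2"
    and mean: "\<And>s. 0 \<le> s \<Longrightarrow> s < 1 \<Longrightarrow>
      integral {0..2*pi} (\<lambda>t. ((norm (f (of_real s * cis t)))\<^sup>2 + N\<^sup>2) powr (q / 2)) \<le> M"
    and r: "0 < r" "r < \<rho>" "\<rho> < 1" and \<kappa>: "\<kappa> > 0"
  shows "(\<integral>\<^sup>+z\<in>cball 0 r. ennreal (norm (deriv f z)) \<partial>lborel)
    \<le> ennreal (\<kappa> / 2 * M + 1 / (2 * \<kappa>) * (N powr (2 - 2 * q) * M * ln (\<rho> / (\<rho> - r))))"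
proof -
  have f1: "deriv f holomorphic_on ball 0 1" using f by (rule holomorphic_deriv) simp
  note cf = holomorphic_on_imp_continuous_on[OF f] holomorphic_on_imp_continuous_on[OF f1]
  define A where "A = (\<lambda>z. (norm (f z))\<^sup>2 + N\<^sup>2)"
  have A: "A z > 0" "A z \<ge> N\<^sup>2" for z using N by (auto simp: A_def add_nonneg_pos)
  have A0: "A z \<noteq> 0" for z using A(1)[of z] by simp
  have cA: "continuous_on (ball 0 1) A" unfolding A_def by (intro continuous_intros cf)
  have M0: "0 \<le> M" using mean[of 0] by (rule order_trans[rotated]) (auto intro: integral_nonneg_total)
  define \<Lambda> where "\<Lambda> s = integral {0..2*pi} (\<lambda>t. (norm (deriv f (of_real s * cis t)))\<^sup>2 *
      A (of_real s * cis t) powr (q / 2 - 1))" for s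
  define J where "J s = integral {0..2*pi} (\<lambda>t. norm (deriv f (of_real s * cis t)))" for s
  have \<Lambda>c: "continuous_on {0..<1} \<Lambda>"
    unfolding \<Lambda>_def by (intro continuous_on_circle_integral[of "\<lambda>z. (norm (deriv f z))\<^sup>2 * A z powr (q / 2 - 1)"]
      continuous_intros cf cA) (use A0 in auto)
  have \<Lambda>0: "\<Lambda> s \<ge> 0" for s unfolding \<Lambda>_def by (intro integral_nonneg_total) auto
  let ?c = "N powr (2 - 2 * q) * M"
  have Jle: "J s \<le> \<kappa> / 2 * ((\<rho> - s) * \<Lambda> s) + 1 / (2 * \<kappa>) * (?c / (\<rho> - s))" if s: "0 \<le> s" "s \<le> r" for s
  proof -
    have s1: "s < 1" "s < \<rho>" using s r by auto
    note I = integrable_integral[OF integrable_continuous_interval]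
    let ?z = "\<lambda>t. of_real s * cis t"
    have 1: "((\<lambda>t. norm (deriv f (?z t))) has_integral J s) {0..2*pi}"
      unfolding J_def using s s1 by (intro I continuous_intros continuous_on_circle[of 1] cf)
    have 2: "((\<lambda>t. (norm (deriv f (?z t)))\<^sup>2 * A (?z t) powr (q / 2 - 1)) has_integral \<Lambda> s) {0..2*pi}"
      unfolding \<Lambda>_def using s s1 A0 by (intro I continuous_intros continuous_on_circle[of 1] cf cA) auto
    have 3: "((\<lambda>t. A (?z t) powr (q / 2)) has_integral integral {0..2*pi} (\<lambda>t. A (?z t) powr (q / 2))) {0..2*pi}"
      using s s1 A0 by (intro I continuous_intros continuous_on_circle[of 1] cA) auto
    have "J s \<le> \<kappa> / 2 * ((\<rho> - s) * \<Lambda> s) + 1 / (2 * \<kappa>) * (1 / (\<rho> - s) * (N powr (2 - 2 * q) *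
        integral {0..2*pi} (\<lambda>t. A (?z t) powr (q / 2))))"
    proof (rule has_integral_le[OF 1])
      show "((\<lambda>t. \<kappa> / 2 * ((\<rho> - s) * ((norm (deriv f (?z t)))\<^sup>2 * A (?z t) powr (q / 2 - 1)))
          + 1 / (2 * \<kappa>) * (1 / (\<rho> - s) * (N powr (2 - 2 * q) * A (?z t) powr (q / 2)))) has_integral
          \<kappa> / 2 * ((\<rho> - s) * \<Lambda> s) + 1 / (2 * \<kappa>) * (1 / (\<rho> - s) * (N powr (2 - 2 * q) *
        integral {0..2*pi} (\<lambda>t. A (?z t) powr (q / 2))))) {0..2*pi}"
        by (intro has_integral_add has_integral_mult_right 2 3)
      fix t
      let ?w = "(\<rho> - s) * A (?z t) powr (q / 2 - 1)"
      have w: "?w > 0" using s1 A0[of "?z t"] by simp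
      \<comment> \<open>The lower bound \<open>N\<^sup>2\<close> for \<open>A\<close> exchanges
        \<open>A powr (1 - q)\<close> for a power of \<open>N\<close>; what is left is
        \<open>A powr (q / 2)\<close>, whose circle mean is at most \<open>M\<close>.\<close>
      have "1 / A (?z t) powr (q / 2 - 1) = A (?z t) powr (1 - q) * A (?z t) powr (q / 2)"
        using A0[of "?z t"] by (simp add: powr_minus_divide[symmetric] powr_add[symmetric])
      also have "\<dots> \<le> (N\<^sup>2) powr (1 - q) * A (?z t) powr (q / 2)"
        using A[of "?z t"] N q by (intro mult_right_mono powr_mono2') auto
      also have "(N\<^sup>2) powr (1 - q) = N powr (2 - 2 * q)"
      proof -
        have "N\<^sup>2 = N powr 2" using N by simp
        then show ?thesis by (simp only: powr_powr) (simp add: algebra_simps)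
      qed
      finally have W: "1 / A (?z t) powr (q / 2 - 1) \<le> N powr (2 - 2 * q) * A (?z t) powr (q / 2)" .
      have "norm (deriv f (?z t)) \<le> \<kappa> / 2 * ((norm (deriv f (?z t)))\<^sup>2 * ?w) + 1 / (2 * \<kappa>) * (1 / ?w)"
        by (rule weighted_am_gm[OF \<kappa> w])
      also have "1 / ?w = 1 / (\<rho> - s) * (1 / A (?z t) powr (q / 2 - 1))" by simp
      also have "\<kappa> / 2 * ((norm (deriv f (?z t)))\<^sup>2 * ?w) + 1 / (2 * \<kappa>) * (1 / (\<rho> - s) * (1 / A (?z t) powr (q / 2 - 1)))
        \<le> \<kappa> / 2 * ((norm (deriv f (?z t)))\<^sup>2 * ?w) + 1 / (2 * \<kappa>) * (1 / (\<rho> - s) * (N powr (2 - 2 * q) * A (?z t) powr (q / 2)))"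
        using \<kappa> s1 by (intro add_left_mono mult_left_mono W) auto
      finally show "norm (deriv f (?z t)) \<le> \<kappa> / 2 * ((\<rho> - s) * ((norm (deriv f (?z t)))\<^sup>2 * A (?z t) powr (q / 2 - 1)))
          + 1 / (2 * \<kappa>) * (1 / (\<rho> - s) * (N powr (2 - 2 * q) * A (?z t) powr (q / 2)))"
        by (simp only: mult_ac)
    qed
    also have "\<dots> \<le> \<kappa> / 2 * ((\<rho> - s) * \<Lambda> s) + 1 / (2 * \<kappa>) * (1 / (\<rho> - s) * (N powr (2 - 2 * q) * M))"
      using \<kappa> s1 s mean[of s] unfolding A_def by (intro add_left_mono mult_left_mono) auto
    finally show ?thesis by simp
  qed
  define h where "h = (\<lambda>z. ennreal (norm (if z \<in> ball 0 1 then deriv f z else 0)) * indicator (cball 0 r) z)"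
  have [measurable]: "(\<lambda>z. if z \<in> ball 0 1 then deriv f z else 0) \<in> borel_measurable borel"
    by (intro borel_measurable_if_continuous_on cf) simp
  have [measurable]: "cball (0::complex) r \<in> sets borel" by simp
  have "(\<integral>\<^sup>+z\<in>cball 0 r. ennreal (norm (deriv f z)) \<partial>lborel) = (\<integral>\<^sup>+z. h z \<partial>lborel)"
    using r by (intro nn_integral_cong) (auto simp: h_def indicator_def)
  also have "\<dots> \<le> (\<integral>\<^sup>+s\<in>{0<..}. (\<integral>\<^sup>+t\<in>{0..2*pi}. h (of_real s * cis t) \<partial>lborel) * ennreal s \<partial>lborel)"
    unfolding h_def by (rule nn_integral_polar_le) measurable
  \<comment> \<open>The first term is continued past \<open>r\<close> to \<open>\<rho>\<close>: it
    is nonnegative there, and \<open>hardy_stein\<close> bounds it up to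
    \<open>\<rho>\<close>.\<close>
  also have "\<dots> \<le> (\<integral>\<^sup>+s. ennreal (\<kappa> / 2) * (ennreal ((\<rho> - s) * s * \<Lambda> s) * indicator {0<..\<rho>} s)
      + ennreal (1 / (2 * \<kappa>)) * (ennreal (?c * (1 / (\<rho> - s))) * indicator {0..r} s) \<partial>lborel)"
  proof (rule nn_integral_mono)
    fix s :: real
    show "(\<integral>\<^sup>+t\<in>{0..2*pi}. h (of_real s * cis t) \<partial>lborel) * ennreal s * indicator {0<..} s
      \<le> ennreal (\<kappa> / 2) * (ennreal ((\<rho> - s) * s * \<Lambda> s) * indicator {0<..\<rho>} s)
      + ennreal (1 / (2 * \<kappa>)) * (ennreal (?c * (1 / (\<rho> - s))) * indicator {0..r} s)"
    proof (cases "s \<in> {0<..r}")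
      case True
      then have s: "0 < s" "s \<le> r" "s < 1" using r by auto
      have "(\<integral>\<^sup>+t\<in>{0..2*pi}. h (of_real s * cis t) \<partial>lborel)
          = (\<integral>\<^sup>+t\<in>{0..2*pi}. ennreal (norm (deriv f (of_real s * cis t))) \<partial>lborel)"
        using s by (intro nn_integral_cong) (auto simp: h_def norm_mult indicator_def)
      also have "\<dots> = ennreal (J s)"
        unfolding J_def using s
        by (intro nn_integral_continuous_interval continuous_intros continuous_on_circle[of 1] cf) auto
      finally have "(\<integral>\<^sup>+t\<in>{0..2*pi}. h (of_real s * cis t) \<partial>lborel) * ennreal s * indicator {0<..} s
          = ennreal (J s * s)"
        using s by (simp add: ennreal_mult'')
      also have "\<dots> \<le> ennreal (\<kappa> / 2 * ((\<rho> - s) * s * \<Lambda> s) + 1 / (2 * \<kappa>) * (?c * (1 / (\<rho> - s))))"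
      proof (rule ennreal_leI)
        have "J s * s \<le> (\<kappa> / 2 * ((\<rho> - s) * \<Lambda> s) + 1 / (2 * \<kappa>) * (?c / (\<rho> - s))) * s"
          using s by (intro mult_right_mono Jle) auto
        also have "\<dots> = \<kappa> / 2 * ((\<rho> - s) * s * \<Lambda> s) + (1 / (2 * \<kappa>) * (?c / (\<rho> - s))) * s"
          by (simp add: algebra_simps)
        \<comment> \<open>The polar factor \<open>s\<close> belongs to the Hardy--Stein integrand
          and stays there; in this term it is estimated by 1.\<close>
        also have "(1 / (2 * \<kappa>) * (?c / (\<rho> - s))) * s \<le> (1 / (2 * \<kappa>) * (?c / (\<rho> - s))) * 1"
          using s r \<kappa> M0 by (intro mult_left_mono) auto
        finally show "J s * s \<le> \<kappa> / 2 * ((\<rho> - s) * s * \<Lambda> s) + 1 / (2 * \<kappa>) * (?c * (1 / (\<rho> - s)))" by simp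
      qed
      also have "\<dots> = ennreal (\<kappa> / 2) * ennreal ((\<rho> - s) * s * \<Lambda> s)
          + ennreal (1 / (2 * \<kappa>)) * ennreal (?c * (1 / (\<rho> - s)))"
      proof -
        have "0 \<le> (\<rho> - s) * s * \<Lambda> s" "0 \<le> ?c * (1 / (\<rho> - s))"
          using s r \<Lambda>0[of s] M0 by auto
        then show ?thesis using \<kappa> by (intro ennreal_linear_combination) auto
      qed
      finally show ?thesis using s r by simp
    next
      case False
      then show ?thesis
        by (cases "s > 0") (auto simp: h_def norm_mult indicator_def)
    qed
  qed
  also have "\<dots> = ennreal (\<kappa> / 2) * (\<integral>\<^sup>+s\<in>{0<..\<rho>}. ennreal ((\<rho> - s) * s * \<Lambda> s) \<partial>lborel)
      + ennreal (1 / (2 * \<kappa>)) * (\<integral>\<^sup>+s\<in>{0..r}. ennreal (?c * (1 / (\<rho> - s))) \<partial>lborel)"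
  proof -
    have "(\<lambda>s. if s \<in> {0<..\<rho>} then (\<rho> - s) * s * \<Lambda> s else 0) \<in> borel_measurable borel"
      using r by (intro borel_measurable_if_continuous_on continuous_intros continuous_on_subset[OF \<Lambda>c]) auto
    then have "(\<lambda>s. ennreal (if s \<in> {0<..\<rho>} then (\<rho> - s) * s * \<Lambda> s else 0)) \<in> borel_measurable borel"
      by measurable
    also have "(\<lambda>s. ennreal (if s \<in> {0<..\<rho>} then (\<rho> - s) * s * \<Lambda> s else 0))
        = (\<lambda>s. ennreal ((\<rho> - s) * s * \<Lambda> s) * indicator {0<..\<rho>} s)" by (auto simp: indicator_def)
    finally have [measurable]: "(\<lambda>s. ennreal ((\<rho> - s) * s * \<Lambda> s) * indicator {0<..\<rho>} s) \<in> borel_measurable borel" .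
    show ?thesis by (subst nn_integral_add) (simp_all add: nn_integral_cmult)
  qed
  also have "\<dots> \<le> ennreal (\<kappa> / 2) * ennreal M + ennreal (1 / (2 * \<kappa>)) * ennreal (?c * ln (\<rho> / (\<rho> - r)))"
  proof (intro add_mono mult_left_mono)
    show "(\<integral>\<^sup>+s\<in>{0<..\<rho>}. ennreal ((\<rho> - s) * s * \<Lambda> s) \<partial>lborel) \<le> ennreal M"
    proof (rule nn_integral_greaterThanAtMost_le)
      show "continuous_on {0<..\<rho>} (\<lambda>s. (\<rho> - s) * s * \<Lambda> s)"
        using r by (intro continuous_intros continuous_on_subset[OF \<Lambda>c]) auto
      fix \<delta> assume \<delta>: "0 < \<delta>" "\<delta> \<le> \<rho>"
      have "integral {\<delta>..\<rho>} (\<lambda>s. (\<rho> - s) * s * \<Lambda> s) \<le> \<rho> * M / q\<^sup>2"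
        unfolding \<Lambda>_def A_def using q r by (intro hardy_stein[OF f N _ _ mean \<delta>]) auto
      also have "\<dots> \<le> M"
      proof -
        have "1 \<le> q\<^sup>2" using q by simp
        then have "\<rho> * M \<le> q\<^sup>2 * M" using r M0 by (intro mult_right_mono) auto
        then show ?thesis using q by (simp add: field_simps)
      qed
      finally show "integral {\<delta>..\<rho>} (\<lambda>s. (\<rho> - s) * s * \<Lambda> s) \<le> M" .
    qed (use r \<Lambda>0 in auto)
    show "(\<integral>\<^sup>+s\<in>{0..r}. ennreal (?c * (1 / (\<rho> - s))) \<partial>lborel) \<le> ennreal (?c * ln (\<rho> / (\<rho> - r)))"
    proof -
      have "(\<integral>\<^sup>+s\<in>{0..r}. ennreal (?c * (1 / (\<rho> - s))) \<partial>lborel) = ennreal (- ?c * ln (\<rho> - r) - (- ?c * ln (\<rho> - 0)))"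
        using r M0 by (intro nn_integral_FTC_Icc) (auto intro!: derivative_eq_intros)
      also have "- ?c * ln (\<rho> - r) - (- ?c * ln (\<rho> - 0)) = ?c * ln (\<rho> / (\<rho> - r))"
        using r by (simp add: ln_div algebra_simps)
      finally show ?thesis by simp
    qed
  qed auto
  also have "\<dots> = ennreal (\<kappa> / 2 * M + 1 / (2 * \<kappa>) * (?c * ln (\<rho> / (\<rho> - r))))"
  proof -
    have "0 \<le> ?c * ln (\<rho> / (\<rho> - r))" using r M0 by (intro mult_nonneg_nonneg) auto
    then show ?thesis using \<kappa> M0 by (intro ennreal_linear_combination[symmetric]) auto
  qed
  finally show ?thesis .
qed

text \<open>The integrand is unbounded at 1, but \<open>1 - 1 / q > 0\<close> makes the
  antiderivative \<open>?F\<close> continuous there, so derivatives in the open interval suffice. By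
  the convention \<open>0 powr x = 0\<close>, both \<open>?F\<close> and the integrand take the
  value 0 at \<open>s = 1\<close>.\<close>

lemma nn_integral_one_minus_powr:
  assumes q: "1 < q" and a: "0 < a"
  shows "(\<integral>\<^sup>+s\<in>{1 - a..<1}. ennreal ((1 - s) powr (- 1 / q)) \<partial>lborel) \<le> ennreal (q / (q - 1) * a powr (1 - 1 / q))"
proof -
  let ?F = "\<lambda>s. - (q / (q - 1) * (1 - s) powr (1 - 1 / q))"
  let ?g = "\<lambda>s. indicator {1 - a..1} s * (1 - s) powr (- 1 / q)"
  have e: "1 - 1 / q > 0" using q by simp
  have "((\<lambda>s. (1 - s) powr (- 1 / q)) has_integral (?F 1 - ?F (1 - a))) {1 - a..1}"
  proof (rule fundamental_theorem_of_calculus_interior)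
    show "continuous_on {1 - a..1} ?F"
      using e by (intro continuous_intros continuous_on_powr') auto
    fix s assume s: "s \<in> {1 - a<..<1}"
    have "((\<lambda>s. (1 - s) powr (1 - 1 / q)) has_real_derivative - ((1 - 1 / q) * (1 - s) powr (- 1 / q))) (at s)"
    proof -
      have "((\<lambda>s. 1 - s) has_real_derivative - 1) (at s)" by (auto intro!: derivative_eq_intros)
      from DERIV_fun_powr[OF this, of "1 - 1 / q"] show ?thesis using s by simp
    qed
    from DERIV_cmult[OF this, of "- (q / (q - 1))"]
    have "(?F has_real_derivative (q / (q - 1)) * ((1 - 1 / q) * (1 - s) powr (- 1 / q))) (at s)" by simp
    moreover have "(q / (q - 1)) * ((1 - 1 / q) * (1 - s) powr (- 1 / q)) = (1 - s) powr (- 1 / q)"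
    proof -
      have "q / (q - 1) * (1 - 1 / q) = 1" using q by (simp add: field_simps)
      then show ?thesis by (simp only: mult.assoc[symmetric] mult_1_left)
    qed
    ultimately show "(?F has_vector_derivative (1 - s) powr (- 1 / q)) (at s)"
      by (simp add: has_real_derivative_iff_has_vector_derivative)
  qed (use a in simp)
  then have "((\<lambda>s. if s \<in> {1 - a..1} then (1 - s) powr (- 1 / q) else 0) has_integral (?F 1 - ?F (1 - a))) UNIV"
    by (simp only: has_integral_restrict_UNIV)
  also have "(\<lambda>s. if s \<in> {1 - a..1} then (1 - s) powr (- 1 / q) else 0) = ?g"
    by (auto simp: indicator_def)
  finally have "(\<integral>\<^sup>+s. ennreal (?g s) \<partial>lborel) = ennreal (?F 1 - ?F (1 - a))"
    by (intro nn_integral_has_integral_lborel) auto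
  moreover have "(\<integral>\<^sup>+s\<in>{1 - a..<1}. ennreal ((1 - s) powr (- 1 / q)) \<partial>lborel) \<le> (\<integral>\<^sup>+s. ennreal (?g s) \<partial>lborel)"
    by (intro nn_integral_mono) (auto simp: indicator_def)
  ultimately show ?thesis using e by simp
qed

text \<open>The reciprocal weight \<open>A powr ((q + 1) / 2)\<close> is the product of the square
  root of \<open>A\<close>, bounded pointwise by the growth estimate, and
  \<open>A powr (q / 2)\<close>, bounded in circle mean by \<open>M\<close>. There remains the
  integrable power \<open>(1 - s) powr (- 1 / q)\<close>. The weighted derivative \<open>D\<close>
  is integrated over the whole disc; smallness in \<open>a\<close> comes from \<open>W\<close>,
  which is confined to the ring.\<close>

lemma integral_deriv_outer_ring_le:
  assumes mv: "mean_valent_on n f (ball 0 1)" and n: "n \<ge> 0" and N: "N > 0" and q: "1 < q" "q \<le> 2"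
    and mean: "\<And>s. 0 \<le> s \<Longrightarrow> s < 1 \<Longrightarrow>
      integral {0..2*pi} (\<lambda>t. ((norm (f (of_real s * cis t)))\<^sup>2 + N\<^sup>2) powr (q / 2)) \<le> M"
    and growth: "\<And>z. norm z < 1 \<Longrightarrow> norm (f z) \<le> B * N * (1 - norm z) powr (- 1 / q)"
    and B: "0 \<le> B" and a: "0 < a" "a < 1" and \<mu>: "\<mu> > 0"
  shows "(\<integral>\<^sup>+z\<in>ball 0 1 - cball 0 (1 - a). ennreal (norm (deriv f z)) \<partial>lborel)
    \<le> ennreal (\<mu> / 2 * (4 * pi * n * (N / 2) powr (1 - q) / (1 - 2 powr (1 - q)))
       + 1 / (2 * \<mu>) * ((B + 1) * N * M * (q / (q - 1) * a powr (1 - 1 / q))))"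
proof -
  have f: "f holomorphic_on ball 0 1" using mv by (simp add: mean_valent_on_def)
  have f1: "deriv f holomorphic_on ball 0 1" using f by (rule holomorphic_deriv) simp
  note cf = holomorphic_on_imp_continuous_on[OF f] holomorphic_on_imp_continuous_on[OF f1]
  define A where "A = (\<lambda>z. (norm (f z))\<^sup>2 + N\<^sup>2)"
  have A: "A z > 0" for z using N by (auto simp: A_def add_nonneg_pos)
  have A0: "A z \<noteq> 0" for z using A[of z] by simp
  have cA: "continuous_on (ball 0 1) A" unfolding A_def by (intro continuous_intros cf)
  have M0: "0 \<le> M" using mean[of 0] by (rule order_trans[rotated]) (auto intro: integral_nonneg_total)
  define D where "D = (\<lambda>z. if z \<in> ball 0 1 then (norm (deriv f z))\<^sup>2 * A z powr (- (q + 1) / 2) else 0)"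
  define W where "W = (\<lambda>z. if z \<in> ball 0 1 then A z powr ((q + 1) / 2) else 0)"
  define S where "S = ball (0::complex) 1 - cball 0 (1 - a)"
  have [measurable]: "S \<in> sets borel" unfolding S_def by simp
  have [measurable]: "D \<in> borel_measurable borel" "W \<in> borel_measurable borel"
    unfolding D_def W_def using A0 by (intro borel_measurable_if_continuous_on continuous_intros cf cA; simp)+
  have 1: "(\<integral>\<^sup>+z. ennreal (D z) \<partial>lborel) \<le> ennreal (4 * pi * n * (N / 2) powr (1 - q) / (1 - 2 powr (1 - q)))"
  proof -
    have "(\<integral>\<^sup>+z. ennreal (D z) \<partial>lborel)
        = (\<integral>\<^sup>+z\<in>ball 0 1. ennreal ((norm (deriv f z))\<^sup>2 * ((norm (f z))\<^sup>2 + N\<^sup>2) powr (- (q + 1) / 2)) \<partial>lborel)"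
      by (intro nn_integral_cong) (auto simp: D_def A_def indicator_def)
    also have "\<dots> \<le> ennreal (4 * pi * n * (N / 2) powr (1 - q) / (1 - 2 powr (1 - q)))"
      by (rule mean_valent_on_weighted_area_le[OF mv open_ball n N q(1)])
    finally show ?thesis .
  qed
  let ?c = "(B + 1) * N * M"
  have c0: "0 \<le> ?c" using B N M0 by simp
  have 2: "(\<integral>\<^sup>+z\<in>S. ennreal (W z) \<partial>lborel) \<le> ennreal (?c * (q / (q - 1) * a powr (1 - 1 / q)))"
  proof -
    have "(\<integral>\<^sup>+z\<in>S. ennreal (W z) \<partial>lborel)
        \<le> (\<integral>\<^sup>+s\<in>{0<..}. (\<integral>\<^sup>+t\<in>{0..2*pi}. ennreal (W (of_real s * cis t)) * indicator S (of_real s * cis t) \<partial>lborel) * ennreal s \<partial>lborel)"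
      by (rule nn_integral_polar_le) measurable
    also have "\<dots> \<le> (\<integral>\<^sup>+s. ennreal ?c * (ennreal ((1 - s) powr (- 1 / q)) * indicator {1 - a..<1} s) \<partial>lborel)"
    proof (rule nn_integral_mono)
      fix s :: real
      show "(\<integral>\<^sup>+t\<in>{0..2*pi}. ennreal (W (of_real s * cis t)) * indicator S (of_real s * cis t) \<partial>lborel) * ennreal s * indicator {0<..} s
        \<le> ennreal ?c * (ennreal ((1 - s) powr (- 1 / q)) * indicator {1 - a..<1} s)"
      proof (cases "0 < s \<and> 1 - a < s \<and> s < 1")
        case True
        then have s: "0 < s" "1 - a < s" "s < 1" by auto
        \<comment> \<open>A bound for \<open>norm (f z) + N\<close>, hence for the square root of
          \<open>A\<close>; the \<open>+ 1\<close> absorbs \<open>N\<close>, since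
          \<open>(1 - s) powr (- 1 / q) \<ge> 1\<close>.\<close>
        let ?b = "(B + 1) * N * (1 - s) powr (- 1 / q)"
        let ?I = "integral {0..2*pi} (\<lambda>t. ?b * A (of_real s * cis t) powr (q / 2))"
        have "W (of_real s * cis t) \<le> ?b * A (of_real s * cis t) powr (q / 2)" for t
        proof -
          define z where "z = of_real s * cis t"
          have z: "norm z = s" using s by (simp add: z_def norm_mult)
          have ge1: "1 \<le> (1 - s) powr (- 1 / q)"
            using s q powr_mono2'[of "- 1 / q" "1 - s" 1] by simp
          have "A z \<le> (norm (f z) + N)\<^sup>2"
            using N by (simp add: A_def power2_sum)
          also have "\<dots> \<le> ?b\<^sup>2"
          proof (rule power_mono)
            have "N \<le> N * (1 - s) powr (- 1 / q)" using ge1 N by simp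
            then show "norm (f z) + N \<le> ?b"
              using growth[of z] z s by (simp add: algebra_simps)
          qed (use N in simp)
          finally have "A z powr (1 / 2) \<le> ?b"
            using A[of z] B N by (simp add: powr_half_sqrt real_le_lsqrt)
          then have "A z powr (1 / 2) * A z powr (q / 2) \<le> ?b * A z powr (q / 2)"
            by (intro mult_right_mono) auto
          also have "A z powr (1 / 2) * A z powr (q / 2) = A z powr ((q + 1) / 2)"
            by (simp add: powr_add[symmetric] add_divide_distrib add.commute)
          finally show ?thesis using z s by (simp add: W_def z_def)
        qed
        then have "(\<integral>\<^sup>+t\<in>{0..2*pi}. ennreal (W (of_real s * cis t)) * indicator S (of_real s * cis t) \<partial>lborel)
            \<le> (\<integral>\<^sup>+t\<in>{0..2*pi}. ennreal (?b * A (of_real s * cis t) powr (q / 2)) \<partial>lborel)"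
          by (intro nn_integral_mono) (auto simp: indicator_def intro!: ennreal_leI)
        also have "\<dots> = ennreal ?I"
          using s B N A0 by (intro nn_integral_continuous_interval continuous_intros continuous_on_circle[of 1] cA) auto
        also have "\<dots> \<le> ennreal (?b * M)"
          using mean[of s] s B N unfolding A_def by (intro ennreal_leI) (simp add: mult_left_mono)
        finally have "(\<integral>\<^sup>+t\<in>{0..2*pi}. ennreal (W (of_real s * cis t)) * indicator S (of_real s * cis t) \<partial>lborel) * ennreal s
            \<le> ennreal (?b * M) * ennreal 1"
          using s by (intro mult_mono ennreal_leI) auto
        also have "\<dots> = ennreal ?c * ennreal ((1 - s) powr (- 1 / q))"
          using c0 by (simp add: ennreal_mult[symmetric] mult_ac)
        finally show ?thesis using s by simp
      next
        case False
        have "norm (of_real s * cis t) = \<bar>s\<bar>" for t by (simp add: norm_mult)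
        then have z: "(\<integral>\<^sup>+t\<in>{0..2*pi}. ennreal (W (of_real s * cis t)) * indicator S (of_real s * cis t) \<partial>lborel) * ennreal s * indicator {0<..} s = 0"
          using False by (cases "s > 0") (auto simp: S_def indicator_def)
        show ?thesis unfolding z by simp
      qed
    qed
    also have "\<dots> = ennreal ?c * (\<integral>\<^sup>+s\<in>{1 - a..<1}. ennreal ((1 - s) powr (- 1 / q)) \<partial>lborel)"
      by (rule nn_integral_cmult) measurable
    also have "\<dots> \<le> ennreal ?c * ennreal (q / (q - 1) * a powr (1 - 1 / q))"
      by (intro mult_left_mono nn_integral_one_minus_powr q a) simp
    also have "\<dots> = ennreal (?c * (q / (q - 1) * a powr (1 - 1 / q)))"
      using c0 q by (intro ennreal_mult[symmetric]) auto
    finally show ?thesis .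
  qed
  have "(\<integral>\<^sup>+z\<in>S. ennreal (norm (deriv f z)) \<partial>lborel)
      \<le> (\<integral>\<^sup>+z. ennreal (\<mu> / 2) * ennreal (D z) + ennreal (1 / (2 * \<mu>)) * (ennreal (W z) * indicator S z) \<partial>lborel)"
  proof (rule nn_integral_mono)
    fix z
    show "ennreal (norm (deriv f z)) * indicator S z
      \<le> ennreal (\<mu> / 2) * ennreal (D z) + ennreal (1 / (2 * \<mu>)) * (ennreal (W z) * indicator S z)"
    proof (cases "z \<in> S")
      case True
      then have z: "z \<in> ball 0 1" by (simp add: S_def)
      have "norm (deriv f z) \<le> \<mu> / 2 * ((norm (deriv f z))\<^sup>2 * A z powr (- (q + 1) / 2)) + 1 / (2 * \<mu>) * (1 / A z powr (- (q + 1) / 2))"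
        using A0[of z] by (intro weighted_am_gm \<mu>) simp
      also have "1 / A z powr (- (q + 1) / 2) = A z powr ((q + 1) / 2)"
        using powr_minus_divide[of "A z" "- (q + 1) / 2"] by (simp only: minus_divide_left minus_minus)
      finally have "norm (deriv f z) \<le> \<mu> / 2 * D z + 1 / (2 * \<mu>) * W z"
        using z unfolding D_def W_def by simp
      then have "ennreal (norm (deriv f z)) \<le> ennreal (\<mu> / 2 * D z + 1 / (2 * \<mu>) * W z)"
        by (rule ennreal_leI)
      also have "\<dots> = ennreal (\<mu> / 2) * ennreal (D z) + ennreal (1 / (2 * \<mu>)) * ennreal (W z)"
        using \<mu> by (intro ennreal_linear_combination) (auto simp: D_def W_def)
      finally show ?thesis using True by simp
    qed simp
  qed
  also have "\<dots> = ennreal (\<mu> / 2) * (\<integral>\<^sup>+z. ennreal (D z) \<partial>lborel) + ennreal (1 / (2 * \<mu>)) * (\<integral>\<^sup>+z\<in>S. ennreal (W z) \<partial>lborel)"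
    by (subst nn_integral_add) (simp_all add: nn_integral_cmult)
  also have "\<dots> \<le> ennreal (\<mu> / 2) * ennreal (4 * pi * n * (N / 2) powr (1 - q) / (1 - 2 powr (1 - q)))
      + ennreal (1 / (2 * \<mu>)) * ennreal (?c * (q / (q - 1) * a powr (1 - 1 / q)))"
    by (intro add_mono mult_left_mono 1 2) auto
  also have "\<dots> = ennreal (\<mu> / 2 * (4 * pi * n * (N / 2) powr (1 - q) / (1 - 2 powr (1 - q)))
       + 1 / (2 * \<mu>) * (?c * (q / (q - 1) * a powr (1 - 1 / q))))"
  proof -
    have "2 powr (1 - q) \<le> 1" using q powr_mono[of "1 - q" 0 "2::real"] by simp
    moreover have "0 \<le> ?c * (q / (q - 1) * a powr (1 - 1 / q))"
      using q by (intro mult_nonneg_nonneg[OF c0]) auto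
    ultimately show ?thesis
      using \<mu> n by (intro ennreal_linear_combination[symmetric]) auto
  qed
  finally show ?thesis unfolding S_def .
qed

section \<open>Choice of the parameters and sum over the two regions\<close>

lemma mean_valent_on_integral_deriv_le:
  assumes mv: "mean_valent_on n f (ball 0 1)" and n: "n > 0" and N: "N > 0" and q: "1 < q" "q \<le> 2"
    and mean: "\<And>s. 0 \<le> s \<Longrightarrow> s < 1 \<Longrightarrow>
      integral {0..2*pi} (\<lambda>t. ((norm (f (of_real s * cis t)))\<^sup>2 + N\<^sup>2) powr (q / 2)) \<le> 8 * pi * N powr q"
  defines "K \<equiv> q / (q - 1)"
  shows "(\<integral>\<^sup>+z\<in>ball 0 1. ennreal (norm (deriv f z)) \<partial>lborel)
    \<le> ennreal ((4 * pi * (1 + 2 * K) + 2 * pi * 2 powr (q - 1) / (1 - 2 powr (1 - q)) + 72 * pi * K)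
        * sqrt (ln (n + 1)) * N)"
proof -
  have f: "f holomorphic_on ball 0 1" using mv by (simp add: mean_valent_on_def)
  have f1: "deriv f holomorphic_on ball 0 1" using f by (rule holomorphic_deriv) simp
  note cf = holomorphic_on_imp_continuous_on[OF f] holomorphic_on_imp_continuous_on[OF f1]
  have K: "K > 0" using q by (simp add: K_def)
  define M where "M = 8 * pi * N powr q"
  define L where "L = ln (n + 1)"
  have L: "L > 0" using n by (simp add: L_def)
  define a where "a = (n + 1) powr - K"
  have a: "0 < a" "a < 1"
    using n K powr_less_mono[of "- K" 0 "n + 1"] by (auto simp: a_def)
  define r where "r = 1 - a"
  \<comment> \<open>Chosen so that \<open>\<rho> / (\<rho> - r) = 1 / a\<^sup>2\<close> holds
    exactly; the logarithm is then \<open>2 * K * L\<close> with no error term.\<close>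
  define \<rho> where "\<rho> = 1 / (1 + a)"
  have r: "0 < r" "r < \<rho>" "\<rho> < 1"
    using a by (auto simp: r_def \<rho>_def field_simps)
  have ln_eq: "ln (\<rho> / (\<rho> - r)) = 2 * K * L"
  proof -
    have "\<rho> - r = a\<^sup>2 / (1 + a)" using a by (simp add: \<rho>_def r_def field_simps power2_eq_square)
    then have "\<rho> / (\<rho> - r) = 1 / a\<^sup>2" using a by (simp add: \<rho>_def)
    then have "ln (\<rho> / (\<rho> - r)) = - 2 * ln a" using a by (simp add: ln_div ln_realpow)
    also have "ln a = - K * L" using n by (simp add: a_def L_def ln_powr)
    finally show ?thesis by simp
  qed
  \<comment> \<open>The constant 17 is \<open>1 + 2 * c / pi\<close> for
    \<open>c = 8 * pi\<close>.\<close>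
  have growth: "norm (f z) \<le> 17 * N * (1 - norm z) powr (- 1 / q)" if "norm z < 1" for z
  proof -
    have "norm (f z) \<le> (1 + 2 * (8 * pi) / pi) * N * (1 - norm z) powr (- 1 / q)"
    proof (rule growth_of_circle_means[OF f N])
      fix s :: real assume s: "0 \<le> s" "s < 1"
      have "integral {0..2*pi} (\<lambda>t. norm (f (of_real s * cis t)) powr q)
          \<le> integral {0..2*pi} (\<lambda>t. ((norm (f (of_real s * cis t)))\<^sup>2 + N\<^sup>2) powr (q / 2))"
      proof (rule integral_le)
        show "(\<lambda>t. norm (f (of_real s * cis t)) powr q) integrable_on {0..2*pi}"
          using s q by (intro integrable_continuous_interval continuous_on_powr' continuous_on_norm
              continuous_on_circle[of 1] cf continuous_on_const) auto
        show "(\<lambda>t. ((norm (f (of_real s * cis t)))\<^sup>2 + N\<^sup>2) powr (q / 2)) integrable_on {0..2*pi}"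
          using s N by (intro integrable_continuous_interval continuous_intros continuous_on_circle[of 1] cf)
            (auto simp: add_nonneg_eq_0_iff)
        fix t
        let ?x = "norm (f (of_real s * cis t))"
        have "?x powr q = (?x powr 2) powr (q / 2)" by (simp only: powr_powr) simp
        also have "\<dots> = (?x\<^sup>2) powr (q / 2)" by simp
        also have "\<dots> \<le> (?x\<^sup>2 + N\<^sup>2) powr (q / 2)" using q by (intro powr_mono2) auto
        finally show "?x powr q \<le> (?x\<^sup>2 + N\<^sup>2) powr (q / 2)" .
      qed
      also note mean[OF s]
      finally show "integral {0..2*pi} (\<lambda>t. norm (f (of_real s * cis t)) powr q) \<le> 8 * pi * N powr q" .
    qed (use q that in auto)
    then show ?thesis by simp
  qed
  have inner: "(\<integral>\<^sup>+z\<in>cball 0 r. ennreal (norm (deriv f z)) \<partial>lborel) \<le> ennreal (4 * pi * (1 + 2 * K) * sqrt L * N)"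
  proof -
    \<comment> \<open>This balances the two terms up to constants: they become
      \<open>4 * pi * sqrt L * N\<close> and \<open>8 * pi * K * sqrt L * N\<close>.\<close>
    define \<kappa> where "\<kappa> = N powr (1 - q) * sqrt L"
    have \<kappa>: "\<kappa> > 0" using N L by (simp add: \<kappa>_def)
    have "(\<integral>\<^sup>+z\<in>cball 0 r. ennreal (norm (deriv f z)) \<partial>lborel)
        \<le> ennreal (\<kappa> / 2 * M + 1 / (2 * \<kappa>) * (N powr (2 - 2 * q) * M * ln (\<rho> / (\<rho> - r))))"
      unfolding M_def by (intro integral_deriv_inner_disc_le f N q mean r \<kappa>)
    also have "\<kappa> / 2 * M + 1 / (2 * \<kappa>) * (N powr (2 - 2 * q) * M * ln (\<rho> / (\<rho> - r)))
        = 4 * pi * (1 + 2 * K) * sqrt L * N"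
    proof -
      define P where "P = N powr q"
      have P: "P > 0" using N by (simp add: P_def)
      have N1: "N powr (1 - q) = N / P" using N by (simp add: P_def powr_diff)
      have "N powr (2 - 2 * q) = N powr (1 - q) * N powr (1 - q)" by (simp add: powr_add[symmetric])
      then have N2: "N powr (2 - 2 * q) = (N / P) * (N / P)" using N1 by simp
      have LL: "L = sqrt L * sqrt L" using L by simp
      define l where "l = sqrt L"
      have l: "l > 0" using L by (simp add: l_def)
      show ?thesis unfolding ln_eq \<kappa>_def N1 N2 M_def P_def[symmetric]
        by (subst (3) LL, unfold l_def[symmetric]) (use P N l in \<open>simp add: field_simps\<close>)
    qed
    finally show ?thesis .
  qed
  have outer: "(\<integral>\<^sup>+z\<in>ball 0 1 - cball 0 r. ennreal (norm (deriv f z)) \<partial>lborel)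
      \<le> ennreal ((2 * pi * 2 powr (q - 1) / (1 - 2 powr (1 - q)) + 72 * pi * K) * sqrt L * N)"
  proof -
    \<comment> \<open>Again a balance: given \<open>a powr (1 - 1 / q) = 1 / (n + 1)\<close>, both
      terms become constant multiples of \<open>N * sqrt (n / (n + 1))\<close>.\<close>
    define \<mu> where "\<mu> = N powr q / sqrt (n * (n + 1))"
    have \<mu>: "\<mu> > 0" using N n by (simp add: \<mu>_def)
    define T where "T = 1 - 2 powr (1 - q)"
    have T: "T > 0" using q powr_less_mono[of "1 - q" 0 "2::real"] by (simp add: T_def)
    have "(\<integral>\<^sup>+z\<in>ball 0 1 - cball 0 r. ennreal (norm (deriv f z)) \<partial>lborel)
      \<le> ennreal (\<mu> / 2 * (4 * pi * n * (N / 2) powr (1 - q) / (1 - 2 powr (1 - q)))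
       + 1 / (2 * \<mu>) * ((17 + 1) * N * M * (q / (q - 1) * a powr (1 - 1 / q))))"
      unfolding r_def M_def using n by (intro integral_deriv_outer_ring_le mv N q mean growth a \<mu>) auto
    also have "\<mu> / 2 * (4 * pi * n * (N / 2) powr (1 - q) / (1 - 2 powr (1 - q)))
       + 1 / (2 * \<mu>) * ((17 + 1) * N * M * (q / (q - 1) * a powr (1 - 1 / q)))
       = (2 * pi * 2 powr (q - 1) / T + 72 * pi * K) * sqrt (n / (n + 1)) * N"
    proof -
      define P where "P = N powr q"
      have P: "P > 0" using N by (simp add: P_def)
      have N1: "(N / 2) powr (1 - q) = N / P * 2 powr (q - 1)"
        using N by (simp add: P_def powr_divide powr_diff)
      have a1: "a powr (1 - 1 / q) = 1 / (n + 1)"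
      proof -
        have "- K * (1 - 1 / q) = - 1" using q by (simp add: K_def field_simps)
        then show ?thesis using n unfolding a_def powr_powr by (simp only: powr_minus_divide powr_one)
      qed
      define u where "u = sqrt n"
      define v where "v = sqrt (n + 1)"
      have uv: "u > 0" "v > 0" "n = u * u" "n + 1 = v * v" using n by (auto simp: u_def v_def)
      have s1: "sqrt (n * (n + 1)) = u * v" by (simp add: u_def v_def real_sqrt_mult)
      have s2: "sqrt (n / (n + 1)) = u / v" by (simp add: u_def v_def real_sqrt_divide)
      have "\<mu> / 2 * (4 * pi * n * (N / 2) powr (1 - q) / T) = 2 * pi * 2 powr (q - 1) / T * (u / v) * N"
        unfolding \<mu>_def s1 N1 P_def[symmetric] unfolding uv(3)
        using uv(1,2) P T by (simp add: field_simps)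
      moreover have "1 / (2 * \<mu>) * ((17 + 1) * N * M * (K * (1 / (n + 1)))) = 72 * pi * K * (u / v) * N"
        unfolding \<mu>_def s1 M_def P_def[symmetric] unfolding uv(4)
        using uv(1,2) P by (simp add: field_simps)
      ultimately show ?thesis
        unfolding s2 a1 K_def[symmetric] T_def[symmetric] by (simp add: algebra_simps)
    qed
    also have "\<dots> \<le> (2 * pi * 2 powr (q - 1) / T + 72 * pi * K) * sqrt L * N"
    proof -
      have "ln (1 / (n + 1)) \<le> 1 / (n + 1) - 1" using n by (intro ln_le_minus_one) simp
      then have "n / (n + 1) \<le> L" using n by (simp add: L_def ln_div field_simps)
      then show ?thesis using N K T by (intro mult_right_mono mult_left_mono real_sqrt_le_mono) auto
    qed
    finally show ?thesis by (simp add: T_def ennreal_leI)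
  qed
  have [measurable]: "(\<lambda>z. if z \<in> ball 0 1 then deriv f z else 0) \<in> borel_measurable borel"
    by (intro borel_measurable_if_continuous_on cf) simp
  let ?d = "\<lambda>z. ennreal (norm (if z \<in> ball 0 1 then deriv f z else 0))"
  have [measurable]: "cball (0::complex) r \<in> sets borel" "ball (0::complex) 1 - cball 0 r \<in> sets borel" by auto
  have "(\<integral>\<^sup>+z\<in>ball 0 1. ennreal (norm (deriv f z)) \<partial>lborel)
      = (\<integral>\<^sup>+z. ?d z * indicator (cball 0 r) z + ?d z * indicator (ball 0 1 - cball 0 r) z \<partial>lborel)"
    using r by (intro nn_integral_cong) (auto simp: indicator_def)
  also have "\<dots> = (\<integral>\<^sup>+z\<in>cball 0 r. ?d z \<partial>lborel) + (\<integral>\<^sup>+z\<in>ball 0 1 - cball 0 r. ?d z \<partial>lborel)"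
    by (rule nn_integral_add) measurable
  also have "(\<integral>\<^sup>+z\<in>cball 0 r. ?d z \<partial>lborel) = (\<integral>\<^sup>+z\<in>cball 0 r. ennreal (norm (deriv f z)) \<partial>lborel)"
    using r by (intro nn_integral_cong) (auto simp: indicator_def)
  also have "(\<integral>\<^sup>+z\<in>ball 0 1 - cball 0 r. ?d z \<partial>lborel) = (\<integral>\<^sup>+z\<in>ball 0 1 - cball 0 r. ennreal (norm (deriv f z)) \<partial>lborel)"
    by (intro nn_integral_cong) (auto simp: indicator_def)
  also have "(\<integral>\<^sup>+z\<in>cball 0 r. ennreal (norm (deriv f z)) \<partial>lborel) + (\<integral>\<^sup>+z\<in>ball 0 1 - cball 0 r. ennreal (norm (deriv f z)) \<partial>lborel)
      \<le> ennreal (4 * pi * (1 + 2 * K) * sqrt L * N)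
        + ennreal ((2 * pi * 2 powr (q - 1) / (1 - 2 powr (1 - q)) + 72 * pi * K) * sqrt L * N)"
    by (intro add_mono inner outer)
  also have "\<dots> = ennreal ((4 * pi * (1 + 2 * K) + 2 * pi * 2 powr (q - 1) / (1 - 2 powr (1 - q)) + 72 * pi * K) * sqrt L * N)"
  proof -
    have "2 powr (1 - q) \<le> 1" using q powr_mono[of "1 - q" 0 "2::real"] by simp
    then show ?thesis using N K L by (subst ennreal_plus[symmetric]) (auto simp: algebra_simps)
  qed
  finally show ?thesis unfolding L_def .
qed

section \<open>From the Hardy norm with exponent \<open>p\<close> to circle means with exponent
  \<open>q\<close>\<close>

lemma hardy_mean_nonneg: "0 \<le> hardy_mean p f r"
  by (simp add: hardy_mean_def)

lemma hardy_mean_le_hardy_norm: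
  assumes "f \<in> hardy_space p" "0 \<le> s" "s < 1"
  shows "hardy_mean p f s \<le> hardy_norm p f"
  unfolding hardy_norm_def using assms by (intro cSUP_upper) (auto simp: hardy_space_def)

text \<open>Allowing any \<open>N\<close> above the norm leaves room for a positive \<open>N\<close>
  when the norm itself is 0.\<close>

lemma integral_powr_circle_le:
  assumes f: "f \<in> hardy_space p" and p: "p > 0" and s: "0 \<le> s" "s < 1" and N: "hardy_norm p f \<le> N"
  shows "integral {0..2*pi} (\<lambda>t. norm (f (of_real s * cis t)) powr p) \<le> 2 * pi * N powr p"
proof -
  let ?I = "integral {0..2*pi} (\<lambda>t. norm (f (of_real s * cis t)) powr p)"
  have I0: "0 \<le> ?I" by (intro integral_nonneg_total) auto
  have "(1 / (2 * pi) * ?I) powr (1 / p) \<le> N"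
    using hardy_mean_le_hardy_norm[OF f s] N by (simp add: hardy_mean_def)
  then have "((1 / (2 * pi) * ?I) powr (1 / p)) powr p \<le> N powr p"
    using p by (intro powr_mono2) auto
  also have "((1 / (2 * pi) * ?I) powr (1 / p)) powr p = 1 / (2 * pi) * ?I"
    using p I0 by (simp add: powr_powr)
  finally show ?thesis by (simp add: field_simps)
qed

text \<open>This is how \<open>p\<close>-means control \<open>q\<close>-means. By homogeneity it is
  a claim about \<open>y = x / N\<close>: for \<open>y \<le> 1\<close> the left side is at most
  \<open>2 powr (q / 2) \<le> 2\<close>, and for \<open>y > 1\<close> at most
  \<open>2 * y powr p\<close>, the power being raised from \<open>q\<close> to
  \<open>p\<close>.\<close>

lemma norm_powr_le_normalized:
  fixes x N p q :: real
  assumes N: "N > 0" and x: "x \<ge> 0" and q: "0 < q" "q \<le> 2" "q \<le> p"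
  shows "(x\<^sup>2 + N\<^sup>2) powr (q / 2) \<le> N powr q * (2 + 2 * (N powr - p * x powr p))"
proof -
  define y where "y = x / N"
  have y: "y \<ge> 0" "x = N * y" using N x by (auto simp: y_def)
  have two: "(2::real) powr (q / 2) \<le> 2" using q powr_mono[of "q / 2" 1 "2::real"] by simp
  have sq: "(u\<^sup>2) powr (q / 2) = u powr q" if "u \<ge> 0" for u :: real
  proof -
    have "(u powr 2) powr (q / 2) = u powr q" by (simp only: powr_powr) simp
    then show ?thesis using that by simp
  qed
  have "(y\<^sup>2 + 1) powr (q / 2) \<le> 2 + 2 * y powr p"
  proof (cases "y \<le> 1")
    case True
    have "(y\<^sup>2 + 1) powr (q / 2) \<le> 2 powr (q / 2)"
      using True y q by (intro powr_mono2) (auto simp: power_le_one)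
    then show ?thesis using two by (simp add: add_increasing2)
  next
    case False
    have "(y\<^sup>2 + 1) powr (q / 2) \<le> (2 * y\<^sup>2) powr (q / 2)"
      using False q by (intro powr_mono2) auto
    also have "\<dots> = 2 powr (q / 2) * y powr q" using y by (simp add: powr_mult sq)
    also have "\<dots> \<le> 2 * y powr p" using two False q by (intro mult_mono powr_mono) auto
    finally show ?thesis by simp
  qed
  then have "N powr q * (y\<^sup>2 + 1) powr (q / 2) \<le> N powr q * (2 + 2 * y powr p)"
    by (intro mult_left_mono) auto
  also have "N powr q * (y\<^sup>2 + 1) powr (q / 2) = (x\<^sup>2 + N\<^sup>2) powr (q / 2)"
  proof -
    have "x\<^sup>2 + N\<^sup>2 = N\<^sup>2 * (y\<^sup>2 + 1)" by (simp add: y power_mult_distrib algebra_simps)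
    then show ?thesis using N by (simp add: powr_mult sq)
  qed
  also have "y powr p = N powr - p * x powr p"
    using N x by (simp add: y_def powr_divide powr_minus field_simps)
  finally show ?thesis .
qed

theorem theorem1p3:
  fixes p :: real
  assumes "p > 1"
  shows "\<exists>C>0. \<forall>(n::real)>0. \<forall>f\<in>hardy_space p. mean_valent_on n f (ball 0 1) \<longrightarrow>
           (\<integral>\<^sup>+z\<in>ball 0 1. ennreal (norm (deriv f z)) \<partial>lborel)
             \<le> ennreal (C * sqrt (ln (n + 1)) * hardy_norm p f)"
proof -
  define q where "q = min p 2"
  have q: "1 < q" "q \<le> 2" "q \<le> p" using assms by (auto simp: q_def)
  define K where "K = q / (q - 1)"
  define C where "C = 4 * pi * (1 + 2 * K) + 2 * pi * 2 powr (q - 1) / (1 - 2 powr (1 - q)) + 72 * pi * K"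
  have K: "K > 0" using q by (simp add: K_def)
  have "2 powr (1 - q) < 1" using q powr_less_mono[of "1 - q" 0 "2::real"] by simp
  then have C: "C > 0" unfolding C_def using K by (intro add_pos_pos mult_pos_pos divide_pos_pos) auto
  have main: "(\<integral>\<^sup>+z\<in>ball 0 1. ennreal (norm (deriv f z)) \<partial>lborel) \<le> ennreal (C * sqrt (ln (n + 1)) * N)"
    if n: "n > 0" and f: "f \<in> hardy_space p" and mv: "mean_valent_on n f (ball 0 1)"
      and N: "N > 0" "hardy_norm p f \<le> N" for n N f
    unfolding C_def K_def
  proof (rule mean_valent_on_integral_deriv_le[OF mv n N(1) q(1,2)])
    fix s :: real assume s: "0 \<le> s" "s < 1"
    have "f holomorphic_on ball 0 1" using f by (simp add: hardy_space_def)
    then have cf: "continuous_on {0..2*pi} (\<lambda>t. f (of_real s * cis t))"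
      using s by (intro continuous_on_circle[of 1] holomorphic_on_imp_continuous_on)
    let ?g = "\<lambda>t. norm (f (of_real s * cis t)) powr p"
    have g: "?g integrable_on {0..2*pi}"
      using assms by (intro integrable_continuous_interval continuous_on_powr' continuous_on_norm cf continuous_on_const) auto
    \<comment> \<open>Each of the two summands of the normalized bound integrates to at most
      \<open>4 * pi\<close>; together they give the constant \<open>8 * pi\<close>.\<close>
    have "integral {0..2*pi} (\<lambda>t. ((norm (f (of_real s * cis t)))\<^sup>2 + N\<^sup>2) powr (q / 2))
        \<le> N powr q * (2 * (2 * pi) + 2 * (N powr - p * integral {0..2*pi} ?g))"
    proof (rule has_integral_le[OF integrable_integral])
      show "(\<lambda>t. ((norm (f (of_real s * cis t)))\<^sup>2 + N\<^sup>2) powr (q / 2)) integrable_on {0..2*pi}"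
        using N by (intro integrable_continuous_interval continuous_intros cf) (auto simp: add_nonneg_eq_0_iff)
      have "((\<lambda>t. 2) has_integral 2 * (2 * pi)) {0..2*pi}"
        using has_integral_const_real[of "2::real" 0 "2*pi"] by simp
      then show "((\<lambda>t. N powr q * (2 + 2 * (N powr - p * ?g t))) has_integral
          N powr q * (2 * (2 * pi) + 2 * (N powr - p * integral {0..2*pi} ?g))) {0..2*pi}"
        using g by (intro has_integral_mult_right has_integral_add) (auto intro: integrable_integral)
    qed (use norm_powr_le_normalized[OF N(1)] q in auto)
    also have "\<dots> \<le> N powr q * (2 * (2 * pi) + 2 * (N powr - p * (2 * pi * N powr p)))"
      using assms by (intro mult_left_mono add_left_mono integral_powr_circle_le f s N) auto
    also have "N powr - p * (2 * pi * N powr p) = 2 * pi"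
      using N by (simp add: powr_minus)
    also have "N powr q * (2 * (2 * pi) + 2 * (2 * pi)) = 8 * pi * N powr q" by simp
    finally show "integral {0..2*pi} (\<lambda>t. ((norm (f (of_real s * cis t)))\<^sup>2 + N\<^sup>2) powr (q / 2)) \<le> 8 * pi * N powr q" .
  qed
  show ?thesis
  proof (intro exI[of _ C] conjI C allI impI ballI)
    fix n :: real and f assume n: "n > 0" and f: "f \<in> hardy_space p" and mv: "mean_valent_on n f (ball 0 1)"
    have N0: "hardy_norm p f \<ge> 0"
      using hardy_mean_le_hardy_norm[OF f, of 0] hardy_mean_nonneg[of p f 0] by simp
    show "(\<integral>\<^sup>+z\<in>ball 0 1. ennreal (norm (deriv f z)) \<partial>lborel) \<le> ennreal (C * sqrt (ln (n + 1)) * hardy_norm p f)"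
    proof (cases "hardy_norm p f > 0")
      case True
      then show ?thesis using main[OF n f mv] by simp
    next
      case False
      \<comment> \<open>The norm is zero: use the bound for every positive \<open>N\<close>.\<close>
      have c: "C * sqrt (ln (n + 1)) > 0" using C n by simp
      show ?thesis
      proof (rule ennreal_le_epsilon)
        fix e :: real assume e: "0 < e"
        define \<epsilon> where "\<epsilon> = e / (C * sqrt (ln (n + 1)))"
        have \<epsilon>: "\<epsilon> > 0" using e c by (simp only: \<epsilon>_def zero_less_divide_iff) simp
        have "(\<integral>\<^sup>+z\<in>ball 0 1. ennreal (norm (deriv f z)) \<partial>lborel) \<le> ennreal (C * sqrt (ln (n + 1)) * \<epsilon>)"
          using False \<epsilon> by (intro main[OF n f mv]) simp_all
        also have "C * sqrt (ln (n + 1)) * \<epsilon> = e"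
        proof -
          have "x * (e / x) = e" if "x > 0" for x using that by simp
          then show ?thesis unfolding \<epsilon>_def using c by blast
        qed
        finally show "(\<integral>\<^sup>+z\<in>ball 0 1. ennreal (norm (deriv f z)) \<partial>lborel)
            \<le> ennreal (C * sqrt (ln (n + 1)) * hardy_norm p f) + ennreal e"
          by (rule order_trans) simp
      qed
    qed
  qed
qed

end
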